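(* Let $(R,\mathfrak{m})$ be a regular local ring with infinite residue field and $\operatorname{depth} R>0$ (equivalently, $R$ is not a field), and let $I$ be a reduction of $\mathfrak{m}$. Then $$n_1(I)=n_2(I)=n_3(I)=0.$$ In particular, $n_1(\mathfrak{m})=n_2(\mathfrak{m})=n_3(\mathfrak{m})=0$.
   Context: All rings are commutative, Noetherian and unital; a local ring is such a ring with a unique maximal ideal $\mathfrak{m}$. For ideals $A,B$ and an element $x$ of $R$, $A:B=\{r\in R\mid rB\subseteq A\}$ and $A:x=A:(x)$. Convention: $\mathfrak{m}^0=R$. Let $(R,\mathfrak{m})$ be a local ring with infinite residue field and let $J$ be an ideal of $R$. - $J$ is $\mathfrak{m}$-full if $J\mathfrak{m}:x=J$ for some element $x\in\mathfrak{m}\setminus\mathfrak{m}^2$. - $J$ is full if $J:x=J:\mathfrak{m}$ for some element $x\in\mathfrak{m}\setminus\mathfrak{m}^2$. - $J$ is weakly $\mathfrak{m}$-full if $J\mathfrak{m}:\mathfrak{m}=J$. If moreover $\operatorname{depth} R>0$ (i.e. $\mathfrak{m}$ contains a non-zero-divisor of $R$), then for an ideal $I$ of $R$ set - $n_1(I)=\min\{t\geq 0\mid I\mathfrak{m}^n \text{ is } \mathfrak{m}\text{-full for all } n\geq t\}$; - $n_2(I)=\min\{t\geq 0\mid I\mathfrak{m}^n \text{ is full for all } n\geq t\}$; - $n_3(I)=\min\{t\geq 0\mid I\mathfrak{m}^n \text{ is weakly } \mathfrak{m}\text{-full for all } n\geq t\}$. It is known (H. Dao) that these minima exist. An ideal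 $I\subseteq\mathfrak{m}$ is a reduction of $\mathfrak{m}$ if $I\mathfrak{m}^r=\mathfrak{m}^{r+1}$ for some integer $r\geq 0$. *)

theory Defs
  imports
    "HOL-Algebra.Ideal_Product"
    "HOL-Algebra.QuotRing"
    "HOL-Algebra.Ring_Divisibility"
    "HOL-Library.Extended_Nat"
begin

section \<open>Regular local rings\<close>

locale noetherian_local_ring = cring R + noetherian_ring R + maximalideal m R
  for R (structure) and m +
  assumes maximal_unique: "maximalideal M R \<Longrightarrow> M = m"

definition krull_dim :: "('a, 'b) ring_scheme \<Rightarrow> enat" where
  "krull_dim R = Sup {enat n | n. \<exists>P. (\<forall>i\<le>n. primeideal (P i) R) \<and> (\<forall>i<n. P i \<subset> P (Suc i))}"

definition min_gens :: "('a, 'b) ring_scheme \<Rightarrow> 'a set \<Rightarrow> nat" where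
  "min_gens R J = (LEAST n. \<exists>S \<subseteq> carrier R. finite S \<and> card S = n \<and> J = Idl\<^bsub>R\<^esub> S)"

locale regular_local_ring = noetherian_local_ring +
  assumes regular: "krull_dim R = enat (min_gens R m)"


section \<open>Colon ideals and depth\<close>

definition ideal_colon :: "('a, 'b) ring_scheme \<Rightarrow> 'a set \<Rightarrow> 'a set \<Rightarrow> 'a set" where
  "ideal_colon R A B = {r \<in> carrier R. \<forall>b\<in>B. r \<otimes>\<^bsub>R\<^esub> b \<in> A}"

abbreviation elem_colon :: "('a, 'b) ring_scheme \<Rightarrow> 'a set \<Rightarrow> 'a \<Rightarrow> 'a set" where
  "elem_colon R A x \<equiv> ideal_colon R A (PIdl\<^bsub>R\<^esub> x)"

text \<open>The colon condition says that the \<open>i\<close>-th entry is a non-zero-divisor modulo the ideal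
  generated by the entries before it.\<close>

definition regular_sequence :: "('a, 'b) ring_scheme \<Rightarrow> 'a list \<Rightarrow> bool" where
  "regular_sequence R xs \<longleftrightarrow>
     set xs \<subseteq> carrier R \<and> Idl\<^bsub>R\<^esub> (set xs) \<noteq> carrier R \<and>
     (\<forall>i<length xs. elem_colon R (Idl\<^bsub>R\<^esub> (set (take i xs))) (xs ! i) = Idl\<^bsub>R\<^esub> (set (take i xs)))"

definition depth :: "('a, 'b) ring_scheme \<Rightarrow> 'a set \<Rightarrow> enat" where
  "depth R m = Sup {enat (length xs) | xs. set xs \<subseteq> m \<and> regular_sequence R xs}"


section \<open>Full ideals\<close>

text \<open>Powers are taken in the library's semiring of ideals, whose unit is \<^term>\<open>carrier R\<close>.\<close>

abbreviation ideal_power :: "('a, 'b) ring_scheme \<Rightarrow> 'a set \<Rightarrow> nat \<Rightarrow> 'a set" where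
  "ideal_power R J n \<equiv> J [^]\<^bsub>ideals_set R\<^esub> n"

definition m_full :: "('a, 'b) ring_scheme \<Rightarrow> 'a set \<Rightarrow> 'a set \<Rightarrow> bool" where
  "m_full R m J \<longleftrightarrow> (\<exists>x \<in> m - ideal_power R m 2. elem_colon R (ideal_prod R J m) x = J)"

definition full :: "('a, 'b) ring_scheme \<Rightarrow> 'a set \<Rightarrow> 'a set \<Rightarrow> bool" where
  "full R m J \<longleftrightarrow> (\<exists>x \<in> m - ideal_power R m 2. elem_colon R J x = ideal_colon R J m)"

definition weakly_m_full :: "('a, 'b) ring_scheme \<Rightarrow> 'a set \<Rightarrow> 'a set \<Rightarrow> bool" where
  "weakly_m_full R m J \<longleftrightarrow> ideal_colon R (ideal_prod R J m) m = J"

text \<open>If no such \<open>t\<close> existed, \<^const>\<open>Least\<close> would be an unspecified number, so \<open>n1 R m I = 0\<close> can only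
  be derived from the property holding at \<open>t = 0\<close>; the same goes for \<open>n2\<close> and \<open>n3\<close>.\<close>

definition n1 :: "('a, 'b) ring_scheme \<Rightarrow> 'a set \<Rightarrow> 'a set \<Rightarrow> nat" where
  "n1 R m I = (LEAST t. \<forall>n\<ge>t. m_full R m (ideal_prod R I (ideal_power R m n)))"

definition n2 :: "('a, 'b) ring_scheme \<Rightarrow> 'a set \<Rightarrow> 'a set \<Rightarrow> nat" where
  "n2 R m I = (LEAST t. \<forall>n\<ge>t. full R m (ideal_prod R I (ideal_power R m n)))"

definition n3 :: "('a, 'b) ring_scheme \<Rightarrow> 'a set \<Rightarrow> 'a set \<Rightarrow> nat" where
  "n3 R m I = (LEAST t. \<forall>n\<ge>t. weakly_m_full R m (ideal_prod R I (ideal_power R m n)))"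

definition reduction :: "('a, 'b) ring_scheme \<Rightarrow> 'a set \<Rightarrow> 'a set \<Rightarrow> bool" where
  "reduction R m I \<longleftrightarrow> ideal I R \<and> I \<subseteq> m \<and>
     (\<exists>r. ideal_prod R I (ideal_power R m r) = ideal_power R m (r + 1))"


section \<open>Positive depth means that the maximal ideal contains a non-zero-divisor\<close>

lemma (in cring) ideal_power_0_Suc:
  "ideal_power R J 0 = carrier R"
  "ideal_power R J (Suc n) = ideal_prod R (ideal_power R J n) J"
  by (simp_all add: nat_pow_def ideals_set_def)

lemma (in cring) genideal_empty: "Idl {} = {\<zero>}"
proof
  show "Idl {} \<subseteq> {\<zero>}"
    using genideal_minimal[OF zeroideal] by simp
  show "{\<zero>} \<subseteq> Idl {}"
    using genideal_ideal[of "{}"] by (simp add: additive_subgroup.zero_closed ideal.axioms(1))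
qed

lemma (in cring) elem_colon_zero:
  assumes x: "x \<in> carrier R"
  shows "elem_colon R {\<zero>} x = {r \<in> carrier R. r \<otimes> x = \<zero>}"
proof -
  have "r \<otimes> (s \<otimes> x) = \<zero>" if "r \<in> carrier R" "s \<in> carrier R" "r \<otimes> x = \<zero>" for r s
  proof -
    have "r \<otimes> (s \<otimes> x) = s \<otimes> (r \<otimes> x)" using that(1,2) x by (rule m_lcomm)
    then show ?thesis using that by simp
  qed
  moreover have "x \<in> PIdl x"
    using x by (rule cgenideal_self)
  ultimately show ?thesis
    by (auto simp: ideal_colon_def cgenideal_def)
qed

lemma (in noetherian_local_ring) depth_pos_iff:
  "depth R m > 0 \<longleftrightarrow> (\<exists>x\<in>m. \<forall>r\<in>carrier R. r \<otimes> x = \<zero> \<longrightarrow> r = \<zero>)"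
proof
  assume "depth R m > 0"
  then obtain xs where xs: "set xs \<subseteq> m" "regular_sequence R xs" "xs \<noteq> []"
    unfolding depth_def by (auto simp: less_Sup_iff enat_0_iff)
  then have "elem_colon R (Idl {}) (xs ! 0) = Idl {}"
    unfolding regular_sequence_def using length_greater_0_conv take_0 set_empty by metis
  moreover have "xs ! 0 \<in> m" using xs by auto
  ultimately show "\<exists>x\<in>m. \<forall>r\<in>carrier R. r \<otimes> x = \<zero> \<longrightarrow> r = \<zero>"
    by (intro bexI[of _ "xs ! 0"]) (auto simp: genideal_empty elem_colon_zero)
next
  assume "\<exists>x\<in>m. \<forall>r\<in>carrier R. r \<otimes> x = \<zero> \<longrightarrow> r = \<zero>"
  then obtain x where x: "x \<in> m" "\<And>r. r \<in> carrier R \<Longrightarrow> r \<otimes> x = \<zero> \<Longrightarrow> r = \<zero>" by blast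
  have "Idl {x} \<subseteq> m" using x by (intro genideal_minimal) (auto intro: is_ideal)
  then have "Idl {x} \<noteq> carrier R" using I_notcarr a_subset by blast
  then have "regular_sequence R [x]"
    using x by (auto simp: regular_sequence_def genideal_empty elem_colon_zero)
  then have "\<exists>y \<in> {enat (length xs) | xs. set xs \<subseteq> m \<and> regular_sequence R xs}. 0 < y"
    using x by (intro bexI[of _ "enat (length [x])"]) (auto simp: zero_enat_def intro!: exI[of _ "[x]"])
  then show "depth R m > 0"
    unfolding depth_def by (simp only: less_Sup_iff)
qed

end

theory Submission
  imports Defs
begin

text \<open>Let \<open>d = dim R\<close> and \<open>m = (y\<^sub>1, \<dots>, y\<^sub>d)\<close>. By Krull's height theorem no ideal generated by fewer
  than \<open>d\<close> elements contains a power of \<open>m\<close>. Hence a form of degree \<open>j\<close> that does not vanish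
  identically over the infinite residue field takes at \<open>y\<close> a value outside \<open>m\<^bsup>j+1\<^esup>\<close>: modulo the
  \<open>d - 1\<close> linear forms vanishing at a point where the form does not, \<open>m\<close> becomes principal. So the
  associated graded ring is a polynomial ring, in particular a domain, and \<open>m\<^bsup>n+1\<^esup> : y\<^sub>d = m\<^sup>n\<close> for all
  \<open>n\<close>, which makes all positive powers of \<open>m\<close> full in each of the three senses. The same consequence
  of the height theorem shows that \<open>m\<close> is its own only reduction.\<close>

text \<open>Everything is computed in \<open>R\<close> itself: no localization, quotient or
  associated graded ring is formed. Localizing at \<open>P\<close> becomes multiplication by
  elements outside \<open>P\<close>, working modulo an ideal becomes adding it, and a nonzero class
  of degree j in the graded ring becomes an element of m^j outside m^(j+1). A form is kept only as a
  function, so being nonzero modulo \<open>m\<close> can only mean having some value outside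
  \<open>m\<close>. This is where the infinite residue field enters: it makes a form with all values
  in \<open>m\<close> take at y a value in m^(j+1), as if its coefficients had been seen to lie in
  \<open>m\<close>. The domain property is needed only for one factor y_d. If r = f(y) lies in m^n
  but not in m^(n+1), then a_d f(a) is outside \<open>m\<close> for some point a. This single
  condition gives a nonvanishing form of degree n+1, whose value at y is y_d r, and also a unit
  coordinate a_d, through which the other variables can be eliminated.\<close>

no_notation Sum_Type.Plus (infixr \<open><+>\<close> 65)

section \<open>Ideals and their powers\<close>

lemma (in cring) ideal_add: "ideal I R \<Longrightarrow> a \<in> I \<Longrightarrow> b \<in> I \<Longrightarrow> a \<oplus> b \<in> I"
  by (simp add: additive_subgroup.a_closed ideal.axioms(1))

lemma (in cring) ideal_uminus: "ideal I R \<Longrightarrow> a \<in> I \<Longrightarrow> \<ominus> a \<in> I"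
  by (simp add: additive_subgroup.a_inv_closed ideal.axioms(1))

lemma (in cring) ideal_diff: "ideal I R \<Longrightarrow> a \<in> I \<Longrightarrow> b \<in> I \<Longrightarrow> a \<ominus> b \<in> I"
  by (simp add: a_minus_def ideal_add ideal_uminus)

lemma (in cring) ideal_zero: "ideal I R \<Longrightarrow> \<zero> \<in> I"
  by (simp add: additive_subgroup.zero_closed ideal.axioms(1))

lemma (in cring) ideal_sub_carrier: "ideal I R \<Longrightarrow> I \<subseteq> carrier R"
  by (simp add: additive_subgroup.a_subset ideal.axioms(1))

lemma (in cring) set_add_memI: "a \<in> I \<Longrightarrow> b \<in> J \<Longrightarrow> a \<oplus> b \<in> I <+> J"
  by (auto simp: set_add_def')

lemma (in cring) set_add_memE:
  assumes "c \<in> I <+> J"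
  obtains a b where "a \<in> I" "b \<in> J" "c = a \<oplus> b"
  using assms by (auto simp: set_add_def')

lemma (in cring) set_add_subset:
  "ideal K R \<Longrightarrow> I \<subseteq> K \<Longrightarrow> J \<subseteq> K \<Longrightarrow> I <+> J \<subseteq> K"
  by (auto simp: set_add_def' intro!: ideal_add)

lemma (in cring) set_add_upper:
  assumes "ideal I R" "ideal J R"
  shows "I \<subseteq> I <+> J" "J \<subseteq> I <+> J"
proof -
  have "I \<union> J \<subseteq> Idl (I \<union> J)"
    using ideal_sub_carrier[OF assms(1)] ideal_sub_carrier[OF assms(2)]
    by (intro genideal_self) auto
  then show "I \<subseteq> I <+> J" "J \<subseteq> I <+> J" by (auto simp: union_genideal[OF assms])
qed

lemma (in cring) ideal_prod_mono:
  assumes "I \<subseteq> I'" "J \<subseteq> J'"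
  shows "ideal_prod R I J \<subseteq> ideal_prod R I' J'"
proof
  fix c assume "c \<in> ideal_prod R I J"
  then show "c \<in> ideal_prod R I' J'"
    by induct (use assms in \<open>auto intro: ideal_prod.intros\<close>)
qed

lemma (in cring) ideal_prod_subsetI:
  assumes "ideal K R" "\<And>a b. a \<in> I \<Longrightarrow> b \<in> J \<Longrightarrow> a \<otimes> b \<in> K"
  shows "ideal_prod R I J \<subseteq> K"
proof
  fix c assume "c \<in> ideal_prod R I J"
  then show "c \<in> K"
    by induct (use assms in \<open>auto intro: ideal_add\<close>)
qed

lemma (in cring) ideal_power_ideal: "ideal J R \<Longrightarrow> ideal (ideal_power R J n) R"
  by (induct n) (simp_all only: ideal_power_0_Suc oneideal ideal_prod_is_ideal)

lemma (in cring) ideal_power_1: "ideal J R \<Longrightarrow> ideal_power R J (Suc 0) = J"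
  using ideal_prod_one[of J] ideal_prod_commute[OF oneideal, of J]
  by (simp only: ideal_power_0_Suc)

lemma (in cring) ideal_power_add:
  assumes "ideal J R"
  shows "ideal_prod R (ideal_power R J a) (ideal_power R J b) = ideal_power R J (a + b)"
proof -
  interpret M: comm_monoid "ideals_set R" by (rule ideals_set_is_comm_monoid)
  have "monoid.mult (ideals_set R) = ideal_prod R" by (simp add: ideals_set_def)
  then show ?thesis
    using M.nat_pow_mult[of J a b] assms by (simp add: ideals_set_def)
qed

lemma (in cring) ideal_power_mult_mem:
  assumes "ideal J R" "x \<in> ideal_power R J a" "y \<in> ideal_power R J b"
  shows "x \<otimes> y \<in> ideal_power R J (a + b)"
  using ideal_power_add[OF assms(1), of a b] ideal_prod.prod[OF assms(2,3), of R] by simp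

lemma (in cring) ideal_power_antimono:
  assumes "ideal J R" "a \<le> b"
  shows "ideal_power R J b \<subseteq> ideal_power R J a"
proof -
  have "ideal_power R J b = ideal_prod R (ideal_power R J a) (ideal_power R J (b - a))"
    using assms by (simp add: ideal_power_add)
  also have "\<dots> \<subseteq> ideal_power R J a"
    using ideal_prod_inter[of "ideal_power R J a" "ideal_power R J (b - a)"] assms
    by (auto simp: ideal_power_ideal)
  finally show ?thesis .
qed

lemma (in cring) prime_power_subset:
  assumes Q: "primeideal Q R" and P: "ideal P R" and sub: "ideal_power R P n \<subseteq> Q"
  shows "P \<subseteq> Q"
  using sub
proof (induct n)
  case 0
  then have "carrier R \<subseteq> Q" by (simp only: ideal_power_0_Suc)
  then show ?case using ideal_sub_carrier[OF P] by blast
next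
  case (Suc n)
  show ?case
  proof (cases "ideal_power R P n \<subseteq> Q")
    case False
    then obtain c where c: "c \<in> ideal_power R P n" "c \<notin> Q" by blast
    show ?thesis
    proof
      fix p assume p: "p \<in> P"
      have "c \<otimes> p \<in> ideal_power R P (Suc n)"
        using c(1) p by (simp only: ideal_power_0_Suc ideal_prod.prod)
      then have "c \<otimes> p \<in> Q" using Suc.prems by blast
      moreover have "c \<in> carrier R" "p \<in> carrier R"
        using ideal.Icarr[OF ideal_power_ideal[OF P] c(1)] ideal.Icarr[OF P p] by auto
      ultimately show "p \<in> Q" using c(2) primeideal.I_prime[OF Q] by blast
    qed
  qed (use Suc in blast)
qed

lemma (in cring) prime_compl_mult:
  assumes "primeideal P R" "s \<in> carrier R - P" "t \<in> carrier R - P"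
  shows "s \<otimes> t \<in> carrier R - P"
  using assms primeideal.I_prime[OF assms(1), of s t] by auto

text \<open>Replaces the fact that, in the localization at \<open>P\<close>, a unit minus an element
  of the maximal ideal is a unit.\<close>

lemma (in cring) prime_compl_diff:
  assumes "ideal P R" "s \<in> carrier R - P" "p \<in> P"
  shows "s \<ominus> p \<in> carrier R - P"
proof -
  have c: "p \<in> carrier R" "s \<in> carrier R" using assms(2) ideal.Icarr[OF assms(1,3)] by auto
  then have "s = (s \<ominus> p) \<oplus> p" by algebra
  then have "s \<ominus> p \<notin> P" using assms ideal_add[OF assms(1), of "s \<ominus> p" p] by auto
  with c show ?thesis by simp
qed

lemma (in cring) prime_one_compl: "primeideal P R \<Longrightarrow> \<one> \<in> carrier R - P"
  using primeideal.I_notcarr[of P R] ideal.one_imp_carrier[of P R] primeideal.axioms(1)[of P R]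
  by auto

lemma (in cring) genideal_insert:
  assumes "g \<in> carrier R" "S \<subseteq> carrier R"
  shows "Idl (insert g S) = PIdl g <+> Idl S"
proof
  have i: "ideal (PIdl g) R" "ideal (Idl S) R"
    using assms by (auto intro: cgenideal_ideal genideal_ideal)
  show "Idl (insert g S) \<subseteq> PIdl g <+> Idl S"
  proof (rule genideal_minimal[OF add_ideals[OF i]])
    show "insert g S \<subseteq> PIdl g <+> Idl S"
      using set_add_upper[OF i] cgenideal_self[OF assms(1)] genideal_self[OF assms(2)] by blast
  qed
  have c: "insert g S \<subseteq> carrier R" using assms by auto
  show "PIdl g <+> Idl S \<subseteq> Idl (insert g S)"
    using genideal_self[OF c]
    by (intro set_add_subset cgenideal_minimal genideal_minimal genideal_ideal[OF c]) auto
qed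

lemma (in cring) genideal_insertE:
  assumes "c \<in> Idl (insert g S)" "g \<in> carrier R" "S \<subseteq> carrier R"
  obtains r e where "r \<in> carrier R" "e \<in> Idl S" "c = r \<otimes> g \<oplus> e"
proof -
  have "c \<in> PIdl g <+> Idl S" using assms by (simp add: genideal_insert)
  then obtain a e where "a \<in> PIdl g" "e \<in> Idl S" "c = a \<oplus> e" by (rule set_add_memE)
  with that show thesis by (auto simp: cgenideal_def)
qed


section \<open>Saturation with respect to a prime ideal\<close>

text \<open>For an ideal \<open>A\<close>, this is the contraction of its extension to the localization at \<open>P\<close>; it lets the
  localization itself be avoided.\<close>

definition (in cring) sat :: "'a set \<Rightarrow> 'a set \<Rightarrow> 'a set" where
  "sat P A = {a \<in> carrier R. \<exists>t \<in> carrier R - P. t \<otimes> a \<in> A}"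

lemma (in cring) satI: "a \<in> carrier R \<Longrightarrow> t \<in> carrier R - P \<Longrightarrow> t \<otimes> a \<in> A \<Longrightarrow> a \<in> sat P A"
  by (auto simp: sat_def)

lemma (in cring) satE:
  assumes "a \<in> sat P A"
  obtains t where "a \<in> carrier R" "t \<in> carrier R - P" "t \<otimes> a \<in> A"
  using assms by (auto simp: sat_def)

lemma (in cring) sat_mono: "A \<subseteq> B \<Longrightarrow> sat P A \<subseteq> sat P B"
  by (auto simp: sat_def)

lemma (in cring) sat_upper: "primeideal P R \<Longrightarrow> ideal A R \<Longrightarrow> A \<subseteq> sat P A"
  using prime_one_compl by (auto simp: ideal.Icarr intro!: satI[where t=\<one>])

lemma (in cring) sat_ideal:
  assumes P: "primeideal P R" and A: "ideal A R"
  shows "ideal (sat P A) R"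
proof (rule idealI[OF ring_axioms])
  show "subgroup (sat P A) (add_monoid R)"
  proof (rule add.subgroupI)
    show "sat P A \<subseteq> carrier R" by (auto simp: sat_def)
    show "sat P A \<noteq> {}" using sat_upper[OF P A] ideal_zero[OF A] by blast
  next
    fix a assume "a \<in> sat P A"
    then obtain t where t: "a \<in> carrier R" "t \<in> carrier R - P" "t \<otimes> a \<in> A" by (rule satE)
    then have "t \<otimes> (\<ominus> a) \<in> A" using ideal_uminus[OF A t(3)] by (simp add: r_minus)
    then show "\<ominus> a \<in> sat P A" using t by (auto intro: satI)
  next
    fix a b assume "a \<in> sat P A" "b \<in> sat P A"
    then obtain t s where ts: "a \<in> carrier R" "t \<in> carrier R - P" "t \<otimes> a \<in> A"
      "b \<in> carrier R" "s \<in> carrier R - P" "s \<otimes> b \<in> A" by (auto elim!: satE)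
    then have "t \<in> carrier R" "s \<in> carrier R" by auto
    with ts(1,4) have "(t \<otimes> s) \<otimes> (a \<oplus> b) = s \<otimes> (t \<otimes> a) \<oplus> t \<otimes> (s \<otimes> b)"
      by algebra
    also have "\<dots> \<in> A" using ts A by (auto intro!: ideal_add ideal.I_l_closed)
    finally show "a \<oplus> b \<in> sat P A"
      using ts prime_compl_mult[OF P, of t s] by (auto intro: satI)
  qed
next
  fix a x assume a: "a \<in> sat P A" and x: "x \<in> carrier R"
  then obtain t where t: "a \<in> carrier R" "t \<in> carrier R - P" "t \<otimes> a \<in> A" by (auto elim: satE)
  then have "t \<otimes> (x \<otimes> a) \<in> A"
    using ideal.I_l_closed[OF A t(3) x] x by (simp add: m_lcomm)
  then show "x \<otimes> a \<in> sat P A" using t x by (auto intro: satI)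
  then show "a \<otimes> x \<in> sat P A" using t x by (simp add: m_comm)
qed

text \<open>Elements outside \<open>P\<close> are also outside the smaller prime \<open>P'\<close>,
  so a contraction from the localization at \<open>P'\<close> is already closed under dividing by
  them.\<close>

lemma (in cring) sat_idem:
  assumes P: "primeideal P R" and PQ: "P' \<subseteq> P" and P': "primeideal P' R"
  shows "sat P (sat P' A) \<subseteq> sat P' A"
proof
  fix a assume "a \<in> sat P (sat P' A)"
  then obtain t s where ts: "a \<in> carrier R" "t \<in> carrier R - P" "s \<in> carrier R - P'"
    "s \<otimes> (t \<otimes> a) \<in> A" by (auto elim!: satE)
  moreover have "s \<otimes> t \<in> carrier R - P'"
    using ts(2,3) PQ prime_compl_mult[OF P', of s t] by blast
  ultimately show "a \<in> sat P' A" by (auto simp: m_assoc intro!: satI[where t="s \<otimes> t"])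
qed

lemma (in cring) sat_notin_cancel:
  assumes "x \<in> carrier R - P" "a \<in> carrier R" "x \<otimes> a \<in> sat P A" "primeideal P R"
  shows "a \<in> sat P A"
  using sat_idem[OF assms(4) order_refl assms(4), of A] assms(1-3) satI by blast

text \<open>Nakayama's lemma for the localization at \<open>P\<close>: each generator is in turn absorbed by a factor
  \<open>t - p\<close> outside \<open>P\<close>.\<close>

lemma (in cring) nakayama_sat_generators:
  assumes P: "primeideal P R" and D: "ideal D R" and S: "finite S" "S \<subseteq> M" and M: "ideal M R"
    and sub: "M \<subseteq> sat P (D <+> ideal_prod R P (Idl S))"
  shows "M \<subseteq> sat P D"
  using S sub
proof (induct S)
  case empty
  have P': "ideal P R" using P by (rule primeideal.axioms(1))
  have "D <+> {\<zero>} = D" using ideal_sub_carrier[OF D] by (force simp: set_add_def')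
  then show ?case using empty ideal_prod_zero[OF P'] genideal_empty by simp
next
  case (insert g S)
  have P': "ideal P R" using P by (rule primeideal.axioms(1))
  have g: "g \<in> carrier R" "g \<in> M" "S \<subseteq> carrier R"
    using insert.prems(1) ideal_sub_carrier[OF M] by auto
  have E: "ideal (ideal_prod R P (Idl S)) R" (is "ideal ?E R")
    using P' g(3) by (intro ideal_prod_is_ideal genideal_ideal)
  have DE: "ideal (D <+> ?E) R" using D E by (rule add_ideals)
  have split: "\<exists>p\<in>P. \<exists>e\<in>?E. c = p \<otimes> g \<oplus> e" if "c \<in> ideal_prod R P (Idl (insert g S))" for c
    using that
  proof induct
    case (prod i j)
    obtain r e where re: "r \<in> carrier R" "e \<in> Idl S" "j = r \<otimes> g \<oplus> e"
      using genideal_insertE[OF prod(2) g(1,3)] by blast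
    have c: "i \<in> carrier R" "e \<in> carrier R"
      using ideal.Icarr[OF P' prod(1)] ideal.Icarr[OF genideal_ideal[OF g(3)] re(2)] by auto
    have "i \<otimes> j = (i \<otimes> r) \<otimes> g \<oplus> i \<otimes> e"
      using c re(1) g(1) unfolding re(3) by algebra
    moreover have "i \<otimes> r \<in> P" using prod(1) re(1) P' by (simp add: ideal.I_r_closed)
    moreover have "i \<otimes> e \<in> ?E" using prod(1) re(2) by (rule ideal_prod.prod)
    ultimately show ?case by blast
  next
    case (sum a b)
    then obtain p e q f where pe: "p \<in> P" "e \<in> ?E" "a = p \<otimes> g \<oplus> e"
      "q \<in> P" "f \<in> ?E" "b = q \<otimes> g \<oplus> f" by blast
    have "p \<in> carrier R" "e \<in> carrier R" "q \<in> carrier R" "f \<in> carrier R"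
      using pe by (auto intro: ideal.Icarr[OF P'] ideal.Icarr[OF E])
    then have "a \<oplus> b = (p \<oplus> q) \<otimes> g \<oplus> (e \<oplus> f)"
      using g(1) unfolding pe(3) pe(6) by algebra
    moreover have "p \<oplus> q \<in> P" "e \<oplus> f \<in> ?E" using pe P' E by (auto intro: ideal_add)
    ultimately show ?case by blast
  qed
  have split': "\<exists>p\<in>P. c \<ominus> p \<otimes> g \<in> D <+> ?E"
    if "c \<in> D <+> ideal_prod R P (Idl (insert g S))" for c
  proof -
    obtain d c' where d: "d \<in> D" "c' \<in> ideal_prod R P (Idl (insert g S))" "c = d \<oplus> c'"
      using \<open>c \<in> _\<close> by (rule set_add_memE)
    then obtain e p where de: "d \<in> D" "p \<in> P" "e \<in> ?E" "c = d \<oplus> (p \<otimes> g \<oplus> e)"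
      using split by blast
    have "d \<in> carrier R" "p \<in> carrier R" "e \<in> carrier R"
      using de by (auto intro: ideal.Icarr[OF P'] ideal.Icarr[OF E] ideal.Icarr[OF D])
    then have "c \<ominus> p \<otimes> g = d \<oplus> e" using g(1) unfolding de(4) by algebra
    then show ?thesis using de(2) set_add_memI[OF de(1,3)] by metis
  qed
  have gsat: "g \<in> sat P (D <+> ?E)"
  proof -
    obtain t where t: "t \<in> carrier R - P" "t \<otimes> g \<in> D <+> ideal_prod R P (Idl (insert g S))"
      using insert.prems(2) g(2) by (blast elim: satE)
    obtain p where p: "p \<in> P" "t \<otimes> g \<ominus> p \<otimes> g \<in> D <+> ?E" using split'[OF t(2)] by blast
    have "p \<in> carrier R" by (rule ideal.Icarr[OF P' p(1)])
    moreover have "t \<in> carrier R" using t by simp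
    ultimately have "t \<otimes> g \<ominus> p \<otimes> g = (t \<ominus> p) \<otimes> g" using g(1) by algebra
    then show ?thesis using p prime_compl_diff[OF P' t(1) p(1)] g(1) by (metis satI)
  qed
  have "M \<subseteq> sat P (D <+> ?E)"
  proof
    fix b assume b: "b \<in> M"
    then obtain t where t: "b \<in> carrier R" "t \<in> carrier R - P"
      "t \<otimes> b \<in> D <+> ideal_prod R P (Idl (insert g S))"
      using insert.prems(2) by (blast elim: satE)
    obtain p where p: "p \<in> P" "t \<otimes> b \<ominus> p \<otimes> g \<in> D <+> ?E" using split'[OF t(3)] by blast
    have pc: "p \<in> carrier R" by (rule ideal.Icarr[OF P' p(1)])
    note si = sat_ideal[OF P DE]
    have "p \<otimes> g \<in> sat P (D <+> ?E)" using gsat pc si by (simp add: ideal.I_l_closed)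
    moreover have "t \<otimes> b \<ominus> p \<otimes> g \<in> sat P (D <+> ?E)" using p(2) sat_upper[OF P DE] by blast
    moreover have "t \<otimes> b = (t \<otimes> b \<ominus> p \<otimes> g) \<oplus> p \<otimes> g"
    proof -
      have "t \<otimes> b \<in> carrier R" "p \<otimes> g \<in> carrier R" using t(1,2) pc g(1) by auto
      then show ?thesis by algebra
    qed
    ultimately have "t \<otimes> b \<in> sat P (D <+> ?E)" using ideal_add[OF si] by metis
    then show "b \<in> sat P (D <+> ?E)" using sat_notin_cancel[OF t(2,1) _ P] by blast
  qed
  then show ?case using insert by blast
qed

section \<open>Noetherian rings: Nakayama's lemma, maximal members of families of ideals, minimal
  primes\<close>

locale noetherian_cring = cring R + noetherian_ring R for R (structure)

sublocale noetherian_local_ring \<subseteq> noetherian_cring ..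

lemma (in noetherian_cring) nakayama_sat:
  assumes P: "primeideal P R" and D: "ideal D R" and M: "ideal M R"
    and sub: "M \<subseteq> sat P (D <+> ideal_prod R P M)"
  shows "M \<subseteq> sat P D"
proof -
  obtain S where "S \<subseteq> carrier R" "finite S" "M = Idl S" using finetely_gen[OF M] by blast
  then show ?thesis using nakayama_sat_generators[OF P D, of S M] genideal_self M sub by blast
qed

text \<open>A nonempty chain of ideals in a Noetherian ring contains its own union, so Zorn's lemma
  applies to a family without any closure property.\<close>

lemma (in noetherian_cring) ex_maximal_ideal:
  assumes ne: "\<F> \<noteq> {}" and id: "\<And>I. I \<in> \<F> \<Longrightarrow> ideal I R"
  obtains M where "M \<in> \<F>" "\<And>X. X \<in> \<F> \<Longrightarrow> M \<subseteq> X \<Longrightarrow> X = M"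
proof -
  have "\<exists>M\<in>\<F>. \<forall>X\<in>\<F>. M \<subseteq> X \<longrightarrow> X = M"
  proof (rule subset_Zorn_nonempty[OF ne])
    fix C assume C: "C \<noteq> {}" "subset.chain \<F> C"
    have "\<F> \<subseteq> {I. ideal I R}" using id by blast
    then have "subset.chain {I. ideal I R} C"
      using C(2) unfolding pred_on.chain_def by (meson subset_trans)
    then have "\<Union>C \<in> C" using ideal_chain_is_trivial C(1) by blast
    then show "\<Union>C \<in> \<F>" using C unfolding pred_on.chain_def by blast
  qed
  then show ?thesis using that by blast
qed

text \<open>An ideal \<open>M\<close> maximal among the ideals above \<open>A\<close> violating the conclusion is prime and lies in \<open>P\<close>.\<close>

lemma (in noetherian_cring) minimal_prime_power:
  assumes P: "primeideal P R" and A: "ideal A R" and AP: "A \<subseteq> P"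
    and min: "\<And>Q. primeideal Q R \<Longrightarrow> A \<subseteq> Q \<Longrightarrow> Q \<subseteq> P \<Longrightarrow> Q = P"
  shows "\<exists>N. ideal_power R P N \<subseteq> sat P A"
proof (rule ccontr)
  assume no: "\<nexists>N. ideal_power R P N \<subseteq> sat P A"
  have P': "ideal P R" using P by (rule primeideal.axioms(1))
  define \<F> where "\<F> = {M. ideal M R \<and> A \<subseteq> M \<and> (\<forall>N. \<not> ideal_power R P N \<subseteq> sat P M)}"
  have "A \<in> \<F>" using A no by (auto simp: \<F>_def)
  then have "\<F> \<noteq> {}" by blast
  then obtain M where M: "M \<in> \<F>" "\<And>X. X \<in> \<F> \<Longrightarrow> M \<subseteq> X \<Longrightarrow> X = M"
    by (rule ex_maximal_ideal) (auto simp: \<F>_def)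
  have Mi: "ideal M R" and AM: "A \<subseteq> M" and Mno: "\<And>N. \<not> ideal_power R P N \<subseteq> sat P M"
    using M(1) by (auto simp: \<F>_def)
  have MP: "M \<subseteq> P"
  proof (rule ccontr)
    assume "\<not> M \<subseteq> P"
    then obtain s where s: "s \<in> M" "s \<in> carrier R - P" using ideal_sub_carrier[OF Mi] by blast
    have "carrier R \<subseteq> sat P M" using s Mi by (auto intro!: satI[where t=s] ideal.I_r_closed)
    then show False using Mno[of 0] unfolding ideal_power_0_Suc by blast
  qed
  have big: "\<exists>N. ideal_power R P N \<subseteq> sat P (M <+> PIdl a)" if "a \<in> carrier R" "a \<notin> M" for a
  proof -
    have i: "ideal (PIdl a) R" using that by (intro cgenideal_ideal)
    have "M <+> PIdl a \<noteq> M" "M \<subseteq> M <+> PIdl a"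
      using set_add_upper[OF Mi i] cgenideal_self[OF that(1)] that(2) by auto
    then have "M <+> PIdl a \<notin> \<F>" using M(2) by blast
    then show ?thesis using add_ideals[OF Mi i] AM set_add_upper(1)[OF Mi i] by (auto simp: \<F>_def)
  qed
  have "primeideal M R"
  proof (rule primeidealI[OF Mi is_cring])
    show "carrier R \<noteq> M" using MP prime_one_compl[OF P] by blast
    fix a b assume ab: "a \<in> carrier R" "b \<in> carrier R" "a \<otimes> b \<in> M"
    show "a \<in> M \<or> b \<in> M"
    proof (rule ccontr)
      assume "\<not> ?thesis"
      then obtain N N' where N: "ideal_power R P N \<subseteq> sat P (M <+> PIdl a)"
        "ideal_power R P N' \<subseteq> sat P (M <+> PIdl b)" using big ab by meson
      \<comment> \<open>(M + (a))(M + (b)) lies in \<open>M\<close> because ab does; hence the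
        exponent N + N' would work for \<open>M\<close> itself.\<close>
      have "ideal_prod R (ideal_power R P N) (ideal_power R P N') \<subseteq> sat P M"
      proof (rule ideal_prod_subsetI[OF sat_ideal[OF P Mi]])
        fix u v assume uv: "u \<in> ideal_power R P N" "v \<in> ideal_power R P N'"
        then obtain s t where st: "u \<in> carrier R" "s \<in> carrier R - P" "s \<otimes> u \<in> M <+> PIdl a"
          "v \<in> carrier R" "t \<in> carrier R - P" "t \<otimes> v \<in> M <+> PIdl b"
          using N by (meson satE subsetD)
        obtain p r where p: "p \<in> M" "r \<in> carrier R" "s \<otimes> u = p \<oplus> r \<otimes> a"
          using st(3) by (elim set_add_memE) (auto simp: cgenideal_def)
        obtain q r' where q: "q \<in> M" "r' \<in> carrier R" "t \<otimes> v = q \<oplus> r' \<otimes> b"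
          using st(6) by (elim set_add_memE) (auto simp: cgenideal_def)
        have pq: "p \<in> carrier R" "q \<in> carrier R"
          using ideal.Icarr[OF Mi] p(1) q(1) by auto
        have "s \<in> carrier R" "t \<in> carrier R" using st by auto
        with st(1,4) have "(s \<otimes> t) \<otimes> (u \<otimes> v) = (s \<otimes> u) \<otimes> (t \<otimes> v)" by algebra
        also have "\<dots> = (q \<oplus> r' \<otimes> b) \<otimes> p \<oplus> (r \<otimes> a) \<otimes> q \<oplus> (r \<otimes> r') \<otimes> (a \<otimes> b)"
          unfolding p(3) q(3) using pq p(2) q(2) ab by algebra
        also have "\<dots> \<in> M" using p q pq ab
          by (simp add: ideal_add[OF Mi] ideal.I_l_closed[OF Mi])
        finally show "u \<otimes> v \<in> sat P M"
          using st prime_compl_mult[OF P st(2,5)] by (auto intro: satI)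
      qed
      then show False using Mno ideal_power_add[OF P'] by metis
    qed
  qed
  then have "M = P" using min AM MP by blast
  then show False using Mno[of "Suc 0"] sat_upper[OF P P'] unfolding ideal_power_1[OF P'] by blast
qed

section \<open>Krull's height theorem\<close>

text \<open>After localizing at \<open>P\<close>, P^i / P^(i+1) is a finite-dimensional vector space
  over the residue field, and the images of the \<open>A n \<inter> P^i\<close> are a descending
  chain of subspaces, which drops only finitely often. In terms of elements: choose
  \<open>v n\<close> at each drop. Some late \<open>v J\<close> is a combination of earlier ones,
  and its coefficients are forced into \<open>P\<close> one by one, from the smallest index upwards,
  which puts \<open>v J\<close> into P^(i+1).\<close>

lemma (in noetherian_cring) finite_level_jumps:
  assumes P: "primeideal P R" and A: "\<And>n. ideal (A n) R" and dec: "decseq A"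
  shows "finite {n. \<not> A n \<inter> ideal_power R P i
    \<subseteq> sat P ((A (Suc n) \<inter> ideal_power R P i) <+> ideal_power R P (Suc i))}" 
proof (rule ccontr)
  define T where "T n = (A (Suc n) \<inter> ideal_power R P i) <+> ideal_power R P (Suc i)" for n
  define B where "B = {n. \<not> A n \<inter> ideal_power R P i \<subseteq> sat P (T n)}"
  assume "\<not> ?thesis"
  then have inf: "infinite B" by (simp add: B_def T_def)
  have P': "ideal P R" using P by (rule primeideal.axioms(1))
  note Pi = ideal_power_ideal[OF P', of i] and PS = ideal_power_ideal[OF P', of "Suc i"]
  have T: "ideal (T n) R" for n
    unfolding T_def by (intro add_ideals i_intersect A Pi PS)
  have "\<forall>n\<in>B. \<exists>v. v \<in> A n \<inter> ideal_power R P i \<and> v \<notin> sat P (T n)"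
    unfolding B_def by blast
  from bchoice[OF this] obtain v
    where v: "\<And>n. n \<in> B \<Longrightarrow> v n \<in> A n \<inter> ideal_power R P i"
      "\<And>n. n \<in> B \<Longrightarrow> v n \<notin> sat P (T n)"
    by blast
  have vc: "v n \<in> carrier R" if "n \<in> B" for n using v(1)[OF that] ideal.Icarr[OF Pi] by blast
  define W where "W k n = Idl (v ` (B \<inter> {k..<n}))" for k n
  have Wi: "ideal (W k n) R" for k n unfolding W_def using vc by (intro genideal_ideal) blast
  have Wsub: "W k n \<subseteq> A k \<inter> ideal_power R P i" for k n
  proof -
    have "v j \<in> A k \<inter> ideal_power R P i" if "j \<in> B" "k \<le> j" for j
      using v(1)[OF that(1)] decseqD[OF dec that(2)] by blast
    then have "v ` (B \<inter> {k..<n}) \<subseteq> A k \<inter> ideal_power R P i" by auto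
    then show ?thesis unfolding W_def by (rule genideal_minimal[OF i_intersect[OF A Pi]])
  qed
  have Wmono: "W k n \<subseteq> W k n'" if "n \<le> n'" for k n n'
    unfolding W_def using vc that by (intro subset_Idl_subset) auto
  \<comment> \<open>The ideals \<open>W 0 n\<close> ascend with \<open>n\<close>, so they become
    stationary.\<close>
  obtain n where n: "\<And>n'. W 0 n \<subseteq> W 0 n' \<Longrightarrow> W 0 n' = W 0 n"
  proof -
    obtain M where M: "M \<in> range (W 0)" "\<And>X. X \<in> range (W 0) \<Longrightarrow> M \<subseteq> X \<Longrightarrow> X = M"
      by (rule ex_maximal_ideal[of "range (W 0)"]) (use Wi in auto)
    then show ?thesis using that by (metis rangeE rangeI)
  qed
  obtain J where J: "J \<in> B" "n < J" using inf by (meson infinite_nat_iff_unbounded)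
  have vJ: "v J \<in> W 0 n"
  proof -
    have "v J \<in> W 0 (Suc J)" unfolding W_def
      using J vc by (intro subsetD[OF genideal_self]) auto
    then show ?thesis using n[of "Suc J"] Wmono[of n "Suc J" 0] J by simp
  qed
  \<comment> \<open>Removes \<open>v k\<close> from the combination. A coefficient of
    \<open>v k\<close> outside \<open>P\<close> would express \<open>v k\<close>, up to that factor,
    by later terms modulo P^(i+1), so there would be no drop at \<open>k\<close>.\<close>
  have "v J \<in> W k n <+> ideal_power R P (Suc i)" if "k \<le> n" for k
    using that
  proof (induct k)
    case 0
    then show ?case using vJ set_add_upper[OF Wi PS] by blast
  next
    case (Suc k)
    show ?case
    proof (cases "k \<in> B")
      case False
      then have "B \<inter> {k..<n} = B \<inter> {Suc k..<n}" using Suc_le_eq le_less by fastforce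
      then show ?thesis using Suc unfolding W_def by simp
    next
      case True
      have eq: "B \<inter> {k..<n} = insert k (B \<inter> {Suc k..<n})" using True Suc.prems by auto
      obtain w p where wp: "w \<in> W k n" "p \<in> ideal_power R P (Suc i)" "v J = w \<oplus> p"
        using Suc by (auto elim: set_add_memE)
      have "w \<in> Idl (insert (v k) (v ` (B \<inter> {Suc k..<n})))"
        using wp(1) unfolding W_def eq by simp
      then obtain c e where ce: "c \<in> carrier R" "e \<in> W (Suc k) n" "w = c \<otimes> v k \<oplus> e"
        unfolding W_def by (rule genideal_insertE) (use True vc in auto)
      have car: "v k \<in> carrier R" "p \<in> carrier R" "e \<in> carrier R" "v J \<in> carrier R"
        using vc True J ideal.Icarr[OF PS wp(2)] ideal.Icarr[OF Wi ce(2)] by auto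
      have "c \<in> P"
      proof (rule ccontr)
        assume "c \<notin> P"
        have "c \<otimes> v k = (v J \<ominus> e) \<oplus> (\<ominus> p)"
          using ce(1) car wp(3) unfolding ce(3) by algebra
        moreover have "v J \<in> A (Suc k) \<inter> ideal_power R P i"
          using v(1)[OF J(1)] decseqD[OF dec, of "Suc k" J] J(2) Suc.prems by auto
        then have "v J \<ominus> e \<in> A (Suc k) \<inter> ideal_power R P i"
          using Wsub ce(2) by (intro ideal_diff i_intersect A Pi) auto
        then have "(v J \<ominus> e) \<oplus> (\<ominus> p) \<in> T k"
          unfolding T_def by (intro set_add_memI ideal_uminus[OF PS] wp)
        ultimately have "v k \<in> sat P (T k)"
          using \<open>c \<notin> P\<close> ce(1) car(1) by (auto intro: satI)
        then show False using v(2)[OF True] by simp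
      qed
      then have "c \<otimes> v k \<in> ideal_power R P (Suc i)"
        using v(1)[OF True] ideal_power_mult_mem[OF P', of c "Suc 0" "v k" i]
        unfolding ideal_power_1[OF P'] by simp
      then have "e \<oplus> (c \<otimes> v k \<oplus> p) \<in> W (Suc k) n <+> ideal_power R P (Suc i)"
        using ce(2) wp(2) by (intro set_add_memI ideal_add[OF PS])
      moreover have "v J = e \<oplus> (c \<otimes> v k \<oplus> p)"
        using car ce(1) unfolding wp(3) ce(3) by algebra
      ultimately show ?thesis by simp
    qed
  qed
  \<comment> \<open>At \<open>k = n\<close> the index interval is empty, so no generators are
    left.\<close>
  from this[of n] have "v J \<in> {\<zero>} <+> ideal_power R P (Suc i)"
    by (simp add: W_def genideal_empty)
  then have "v J \<in> ideal_power R P (Suc i)"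
    by (elim set_add_memE) (use ideal.Icarr[OF PS] in auto)
  also have "\<dots> \<subseteq> T J"
    unfolding T_def by (intro set_add_upper i_intersect A Pi PS)
  also have "\<dots> \<subseteq> sat P (T J)" by (intro sat_upper P T)
  finally show False using v(2)[OF J(1)] by simp
qed

text \<open>The descending chain condition in the Artinian ring obtained by localizing at \<open>P\<close> and dividing
  by the \<open>N\<close>-th power of its maximal ideal, applied to consecutive terms of a sequence.\<close>

lemma (in noetherian_cring) artinian_stationary:
  assumes P: "primeideal P R" and A: "\<And>n. ideal (A n) R" and dec: "decseq A"
    and sat: "\<And>n. sat P (A n) \<subseteq> A n" and PN: "\<And>n. ideal_power R P N \<subseteq> A n"
  shows "\<exists>n. A n \<subseteq> A (Suc n)"
proof -
  have P': "ideal P R" using P by (rule primeideal.axioms(1))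
  define B where "B i = {n. \<not> A n \<inter> ideal_power R P i
    \<subseteq> sat P ((A (Suc n) \<inter> ideal_power R P i) <+> ideal_power R P (Suc i))}" for i
  have "finite (\<Union>i<N. B i)" unfolding B_def using finite_level_jumps[where A=A, OF P A dec] by simp
  \<comment> \<open>Since P^N lies in every \<open>A n\<close>, only the levels below
    \<open>N\<close> can change; this index has no drop at any of them.\<close>
  then obtain n where n: "n \<notin> (\<Union>i<N. B i)" using ex_new_if_finite infinite_UNIV_nat by blast
  \<comment> \<open>Descends through the levels: from P^N, where the inclusion is given, to P^0,
    which is the whole ring.\<close>
  have "A n \<inter> ideal_power R P (N - k) \<subseteq> A (Suc n)" for k
  proof (induct k)
    case 0
    then show ?case using PN by auto
  next
    case (Suc k)
    show ?case
    proof (cases "k < N")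
      case True
      define i where "i = N - Suc k"
      have i: "i < N" "Suc i = N - k" using True by (auto simp: i_def)
      show ?thesis
      proof
        fix a assume a: "a \<in> A n \<inter> ideal_power R P (N - Suc k)"
        then have "a \<in> sat P ((A (Suc n) \<inter> ideal_power R P i) <+> ideal_power R P (Suc i))"
          using n i(1) unfolding B_def i_def[symmetric] by blast
        then obtain t where t: "a \<in> carrier R" "t \<in> carrier R - P"
          "t \<otimes> a \<in> (A (Suc n) \<inter> ideal_power R P i) <+> ideal_power R P (Suc i)" by (rule satE)
        from t(3) obtain b c where bc: "b \<in> A (Suc n)" "c \<in> ideal_power R P (Suc i)" "t \<otimes> a = b \<oplus> c"
          by (elim set_add_memE) auto
        have car: "b \<in> carrier R" "c \<in> carrier R" "t \<otimes> a \<in> carrier R"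
          using ideal.Icarr[OF A bc(1)] ideal.Icarr[OF ideal_power_ideal[OF P'] bc(2)] t by auto
        have "t \<otimes> a \<in> A n" using a t A ideal.I_l_closed by fast
        moreover have "b \<in> A n" using decseqD[OF dec, of n "Suc n"] bc(1) by auto
        ultimately have "t \<otimes> a \<ominus> b \<in> A n" by (rule ideal_diff[OF A])
        moreover have "t \<otimes> a \<ominus> b = c" using car(1,2) unfolding bc(3) by algebra
        ultimately have "c \<in> A (Suc n)" using Suc bc(2) i by auto
        then have "t \<otimes> a \<in> A (Suc n)" unfolding bc(3) using bc(1) by (intro ideal_add[OF A])
        then show "a \<in> A (Suc n)" using sat satI[OF t(1,2)] by blast
      qed
    next
      case False
      then have "N - Suc k = N - k" by simp
      then show ?thesis using Suc by simp
    qed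
  qed
  from this[of N] have "A n \<inter> carrier R \<subseteq> A (Suc n)" by (simp only: diff_self_eq_0 ideal_power_0_Suc)
  then show ?thesis using ideal_sub_carrier[OF A] by blast
qed

text \<open>Krull's principal ideal theorem for \<open>R / P0\<close>: if no such \<open>Q'\<close> existed, \<open>P\<close> would be minimal
  over \<open>x\<close>, and the symbolic powers of \<open>Q\<close> would become stationary.\<close>

lemma (in noetherian_cring) prime_exchange:
  assumes P0: "primeideal P0 R" and Q: "primeideal Q R" and P: "primeideal P R"
    and PQ: "P0 \<subset> Q" and QP: "Q \<subset> P" and x: "x \<in> P"
  shows "\<exists>Q'. primeideal Q' R \<and> P0 \<subset> Q' \<and> Q' \<subset> P \<and> x \<in> Q'"
proof (cases "x \<in> Q")
  case True
  then show ?thesis using Q PQ QP by blast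
next
  case xQ: False
  have i: "ideal P0 R" "ideal Q R" "ideal P R"
    using P0 Q P by (auto dest: primeideal.axioms(1))
  have xc: "x \<in> carrier R" by (rule ideal.Icarr[OF i(3) x])
  have xi: "ideal (PIdl x) R" by (rule cgenideal_ideal[OF xc])
  have P0x: "ideal (P0 <+> PIdl x) R" using i(1) xi by (rule add_ideals)
  show ?thesis
  proof (rule ccontr)
    assume no: "\<not> ?thesis"
    have "\<exists>N. ideal_power R P N \<subseteq> sat P (P0 <+> PIdl x)"
    proof (rule minimal_prime_power[OF P P0x])
      show "P0 <+> PIdl x \<subseteq> P"
        using PQ QP x i by (intro set_add_subset cgenideal_minimal) auto
      fix Q' assume Q': "primeideal Q' R" "P0 <+> PIdl x \<subseteq> Q'" "Q' \<subseteq> P"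
      then have "P0 \<subseteq> Q'" "x \<in> Q'"
        using set_add_upper[OF i(1) xi] cgenideal_self[OF xc] by auto
      moreover have "x \<notin> P0" using xQ PQ by auto
      ultimately show "Q' = P" using no Q' by blast
    qed
    then obtain N where N: "ideal_power R P N \<subseteq> sat P (P0 <+> PIdl x)" ..
    \<comment> \<open>\<open>B n\<close> is the preimage in \<open>R\<close> of the n-th symbolic
      power of Q / P0. Adding \<open>x\<close> and contracting from \<open>P\<close> gives
      \<open>A n\<close>, a sequence lying above the fixed power P^N.\<close>
    define B where "B n = sat Q (P0 <+> ideal_power R Q n)" for n
    define A where "A n = sat P (B n <+> PIdl x)" for n
    have si: "ideal (P0 <+> ideal_power R Q n) R" for n
      by (intro add_ideals ideal_power_ideal i)
    have B: "ideal (B n) R" for n unfolding B_def by (rule sat_ideal[OF Q si])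
    have Bx: "ideal (B n <+> PIdl x) R" for n by (rule add_ideals[OF B xi])
    have A: "ideal (A n) R" for n unfolding A_def by (rule sat_ideal[OF P Bx])
    have P0B: "P0 \<subseteq> B n" and QB: "ideal_power R Q n \<subseteq> B n" for n
      using set_add_upper[OF i(1) ideal_power_ideal[OF i(2), of n]] sat_upper[OF Q si[of n]]
      unfolding B_def by auto
    have Bdec: "B (Suc n) \<subseteq> B n" for n
      unfolding B_def
      using set_add_upper[OF i(1) ideal_power_ideal[OF i(2), of n]]
        ideal_power_antimono[OF i(2), of n "Suc n"]
      by (intro sat_mono set_add_subset[OF si]) auto
    have "\<exists>n. A n \<subseteq> A (Suc n)"
    proof (rule artinian_stationary[where A=A and N=N, OF P A])
      show "decseq A"
        unfolding A_def using Bdec set_add_upper[OF B xi]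
        by (intro decseq_SucI sat_mono set_add_subset[OF Bx]) (auto dest: subset_trans)
      show "sat P (A n) \<subseteq> A n" for n unfolding A_def by (rule sat_idem[OF P order_refl P])
      have "P0 <+> PIdl x \<subseteq> B n <+> PIdl x" for n
        using P0B set_add_upper[OF B xi] by (intro set_add_subset[OF Bx]) (auto dest: subset_trans)
      then show "ideal_power R P N \<subseteq> A n" for n
        unfolding A_def using N sat_mono by (meson subset_trans)
    qed
    then obtain n where n: "A n \<subseteq> A (Suc n)" ..
    \<comment> \<open>Stationarity gives tb = b' + rx with \<open>b'\<close> in
      \<open>B (Suc n)\<close>. Then rx lies in \<open>B n\<close>, and \<open>r\<close> does too
      because \<open>x\<close> is outside \<open>Q\<close>. So the error lies in P B_n, and Nakayama
      at \<open>P\<close> removes it.\<close>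
    have "B n \<subseteq> sat P (B (Suc n) <+> ideal_prod R P (B n))"
    proof
      fix b assume b: "b \<in> B n"
      then have "b \<in> A n"
        unfolding A_def using sat_upper[OF P Bx] set_add_upper[OF B xi] by blast
      then have "b \<in> sat P (B (Suc n) <+> PIdl x)" using n unfolding A_def by blast
      then obtain t where t: "b \<in> carrier R" "t \<in> carrier R - P" "t \<otimes> b \<in> B (Suc n) <+> PIdl x"
        by (rule satE)
      from t(3) obtain b' r where r: "b' \<in> B (Suc n)" "r \<in> carrier R" "t \<otimes> b = b' \<oplus> r \<otimes> x"
        by (elim set_add_memE) (auto simp: cgenideal_def)
      have car: "b' \<in> carrier R" "t \<in> carrier R" using ideal.Icarr[OF B r(1)] t by auto
      have "t \<otimes> b \<ominus> b' \<in> B n"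
        using b car r(1) Bdec by (intro ideal_diff[OF B] ideal.I_l_closed[OF B]) auto
      moreover have "t \<otimes> b \<ominus> b' = x \<otimes> r"
        using car(1) r(2) xc unfolding r(3) by algebra
      ultimately have xr: "x \<otimes> r \<in> B n" by simp
      have "x \<in> carrier R - Q" using xc xQ by simp
      then have "r \<in> B n"
        using sat_notin_cancel[OF _ r(2) xr[unfolded B_def] Q] unfolding B_def by blast
      then have "x \<otimes> r \<in> ideal_prod R P (B n)" using x by (intro ideal_prod.prod)
      then have "t \<otimes> b \<in> B (Suc n) <+> ideal_prod R P (B n)"
        unfolding r(3) using r(1) set_add_memI m_comm[OF r(2) xc] by metis
      then show "b \<in> sat P (B (Suc n) <+> ideal_prod R P (B n))" using t satI by blast
    qed
    then have "B n \<subseteq> sat P (B (Suc n))" by (rule nakayama_sat[OF P B B])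
    also have "\<dots> \<subseteq> B (Suc n)"
      unfolding B_def using QP by (intro sat_idem[OF P _ Q]) auto
    finally have BB: "B n \<subseteq> B (Suc n)" .
    \<comment> \<open>Now Nakayama at \<open>Q\<close>: equality of consecutive symbolic powers
      makes Q^n vanish modulo \<open>P0\<close>, against \<open>P0 \<subset> Q\<close>.\<close>
    have "B n \<subseteq> sat Q (P0 <+> ideal_prod R Q (B n))"
    proof -
      have "ideal_power R Q (Suc n) \<subseteq> ideal_prod R Q (B n)"
      proof -
        have "ideal_power R Q (Suc n) = ideal_prod R Q (ideal_power R Q n)"
          unfolding ideal_power_0_Suc by (rule ideal_prod_commute[OF ideal_power_ideal[OF i(2)] i(2)])
        then show ?thesis using QB ideal_prod_mono[of Q Q] by simp
      qed
      moreover have pi: "ideal (ideal_prod R Q (B n)) R" by (rule ideal_prod_is_ideal[OF i(2) B])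
      ultimately have "P0 <+> ideal_power R Q (Suc n) \<subseteq> P0 <+> ideal_prod R Q (B n)"
        using set_add_upper[OF i(1) pi] by (intro set_add_subset add_ideals i(1)) auto
      then show ?thesis using BB sat_mono unfolding B_def[of "Suc n"] by blast
    qed
    then have "B n \<subseteq> sat Q P0" by (rule nakayama_sat[OF Q i(1) B])
    also have "\<dots> \<subseteq> P0"
    proof
      fix a assume "a \<in> sat Q P0"
      then obtain t where "a \<in> carrier R" "t \<in> carrier R - Q" "t \<otimes> a \<in> P0" by (rule satE)
      then show "a \<in> P0" using primeideal.I_prime[OF P0, of t a] PQ by auto
    qed
    finally have "ideal_power R Q n \<subseteq> P0" using QB by blast
    then have "Q \<subseteq> P0" by (rule prime_power_subset[OF P0 i(2)])
    then show False using PQ by blast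
  qed
qed

section \<open>Chains of primes: from one element to several\<close>

definition (in cring) prime_chain :: "nat \<Rightarrow> (nat \<Rightarrow> 'a set) \<Rightarrow> bool" where
  "prime_chain n P \<longleftrightarrow> (\<forall>i\<le>n. primeideal (P i) R) \<and> (\<forall>i<n. P i \<subset> P (Suc i))"

text \<open>Pushes \<open>x\<close> down the chain: \<open>prime_exchange\<close> on the top three
  primes puts \<open>x\<close> into the middle one, and the induction continues with the chain
  ending there.\<close>

lemma (in noetherian_cring) prime_chain_move:
  assumes "prime_chain (Suc n) P" "x \<in> P (Suc n)"
  shows "\<exists>P'. prime_chain (Suc n) P' \<and> P' 0 = P 0 \<and> P' (Suc n) = P (Suc n) \<and> x \<in> P' 1"
  using assms
proof (induct n arbitrary: P)
  case 0
  then show ?case by auto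
next
  case (Suc n)
  have c: "primeideal (P i) R" if "i \<le> Suc (Suc n)" for i
    using Suc.prems(1) that by (simp add: prime_chain_def)
  have s: "P i \<subset> P (Suc i)" if "i \<le> Suc n" for i
    using Suc.prems(1) that by (simp add: prime_chain_def)
  obtain Q where Q: "primeideal Q R" "P n \<subset> Q" "Q \<subset> P (Suc (Suc n))" "x \<in> Q"
    using prime_exchange[OF c[of n] c[of "Suc n"] c[of "Suc (Suc n)"] s[of n] s[of "Suc n"]]
      Suc.prems(2) by (metis le_add2 le_refl le_SucI)
  have "prime_chain (Suc n) (P(Suc n := Q))"
    using c s Q by (auto simp: prime_chain_def less_Suc_eq)
  then obtain P' where P': "prime_chain (Suc n) P'" "P' 0 = P 0" "P' (Suc n) = Q" "x \<in> P' 1"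
    using Suc.hyps[of "P(Suc n := Q)"] Q(4) by (metis fun_upd_same fun_upd_other nat.distinct(1))
  have "prime_chain (Suc (Suc n)) (P'(Suc (Suc n) := P (Suc (Suc n))))"
    using P' Q c by (auto simp: prime_chain_def less_Suc_eq le_Suc_eq)
  moreover have "(P'(Suc (Suc n) := P (Suc (Suc n)))) 0 = P 0"
    "x \<in> (P'(Suc (Suc n) := P (Suc (Suc n)))) 1" using P' by auto
  ultimately show ?case by (metis fun_upd_same)
qed

text \<open>Each element costs one prime: once \<open>y\<close> lies in the second prime, the bottom
  prime is dropped and the remaining elements are treated. With fewer elements than inclusions, a
  prime strictly below the top survives.\<close>

lemma (in noetherian_cring) height_theorem:
  assumes "prime_chain n P" "length ys < n" "set ys \<subseteq> P n"
  shows "\<exists>Q. primeideal Q R \<and> P 0 \<subseteq> Q \<and> Q \<subset> P n \<and> set ys \<subseteq> Q"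
  using assms
proof (induct ys arbitrary: n P)
  case Nil
  then obtain k where k: "n = Suc k" by (cases n) auto
  have "primeideal (P k) R" "P k \<subset> P n" using Nil(1) k by (auto simp: prime_chain_def)
  moreover have "P 0 \<subseteq> P k"
  proof -
    have "P 0 \<subseteq> P j" if "j \<le> n" for j
      using that
    proof (induct j)
      case (Suc j)
      have "P j \<subset> P (Suc j)" using Nil(1) Suc.prems by (simp add: prime_chain_def)
      then show ?case using Suc by auto
    qed simp
    then show ?thesis using k by simp
  qed
  ultimately show ?case by auto
next
  case (Cons y ys)
  then obtain k where k: "n = Suc k" by (cases n) auto
  obtain P' where P': "prime_chain (Suc k) P'" "P' 0 = P 0" "P' (Suc k) = P (Suc k)" "y \<in> P' 1"
    using prime_chain_move[of k P y] Cons.prems k by auto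
  have "prime_chain k (\<lambda>i. P' (Suc i))" using P'(1) by (auto simp: prime_chain_def)
  then obtain Q where Q: "primeideal Q R" "P' (Suc 0) \<subseteq> Q" "Q \<subset> P' (Suc k)" "set ys \<subseteq> Q"
    using Cons.hyps[of k "\<lambda>i. P' (Suc i)"] Cons.prems k P'(3) by auto
  have "P' 0 \<subseteq> P' (Suc 0)" using P'(1) by (auto simp: prime_chain_def)
  then have "P 0 \<subseteq> Q" "Q \<subset> P n" "set (y # ys) \<subseteq> Q" using Q P' k by auto
  then show ?case using Q(1) by blast
qed

section \<open>Noetherian local rings\<close>

context noetherian_local_ring
begin

lemma m_prime: "primeideal m R"
  using is_maximalideal by (rule maximalideal_prime)

lemma proper_ideal_subset: "ideal I R \<Longrightarrow> I \<noteq> carrier R \<Longrightarrow> I \<subseteq> m"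
proof -
  assume I: "ideal I R" "I \<noteq> carrier R"
  define F where "F = {J. ideal J R \<and> I \<subseteq> J \<and> J \<noteq> carrier R}"
  have "I \<in> F" using I by (simp add: F_def)
  then have "F \<noteq> {}" by blast
  then obtain M where M: "M \<in> F" "\<And>X. X \<in> F \<Longrightarrow> M \<subseteq> X \<Longrightarrow> X = M"
    by (rule ex_maximal_ideal) (auto simp: F_def)
  then have "maximalideal M R" by (intro maximalidealI) (auto simp: F_def)
  then show "I \<subseteq> m" using maximal_unique M(1) by (auto simp: F_def)
qed

lemma notin_maximal_Units: "t \<in> carrier R \<Longrightarrow> t \<notin> m \<Longrightarrow> t \<in> Units R"
proof -
  assume t: "t \<in> carrier R" "t \<notin> m"
  then have "PIdl t = carrier R"
    using proper_ideal_subset[OF cgenideal_ideal[OF t(1)]] cgenideal_self[OF t(1)] by blast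
  then have "\<one> \<in> PIdl t" by simp
  then obtain s where "s \<in> carrier R" "s \<otimes> t = \<one>" by (auto simp: cgenideal_def)
  then show "t \<in> Units R" using t(1) m_comm unfolding Units_def by auto
qed

lemma unit_cancel_mem:
  assumes "ideal A R" "t \<in> carrier R" "t \<notin> m" "a \<in> carrier R" "t \<otimes> a \<in> A"
  shows "a \<in> A"
proof -
  have t: "t \<in> Units R" using assms notin_maximal_Units by blast
  have "inv t \<otimes> (t \<otimes> a) \<in> A" using assms(5) t by (simp add: ideal.I_l_closed[OF assms(1)])
  moreover have "inv t \<otimes> (t \<otimes> a) = a" using t assms by (simp add: m_assoc[symmetric])
  ultimately show ?thesis by simp
qed

text \<open>Elements outside \<open>m\<close> are units, so contracting from the localization at
  \<open>m\<close> changes no ideal and the localized version applies with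
  \<open>P = m\<close>.\<close>

lemma nakayama:
  assumes "ideal D R" "ideal M R" "M \<subseteq> D <+> ideal_prod R M m"
  shows "M \<subseteq> D"
proof -
  have "M \<subseteq> sat m (D <+> ideal_prod R m M)"
    using assms sat_upper[OF m_prime add_ideals[OF assms(1) ideal_prod_is_ideal[OF is_ideal assms(2)]]]
    by (simp add: ideal_prod_commute[OF assms(2) is_ideal])
  then have "M \<subseteq> sat m D" by (rule nakayama_sat[OF m_prime assms(1,2)])
  also have "\<dots> \<subseteq> D" using unit_cancel_mem[OF assms(1)] by (auto elim!: satE)
  finally show ?thesis .
qed

lemma nakayama_power:
  assumes "ideal D R" "ideal_power R m n \<subseteq> D <+> ideal_power R m (Suc n)"
  shows "ideal_power R m n \<subseteq> D"
  using nakayama[OF assms(1) ideal_power_ideal[OF is_ideal, of n]] assms(2)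
  unfolding ideal_power_0_Suc by blast

end


section \<open>Homogeneous polynomial functions\<close>

text \<open>Functions induced by forms of degree \<open>j\<close> in the first \<open>d\<close> of infinitely many variables. Only the
  values matter, so no type of multivariate polynomials is needed.\<close>

inductive (in cring) hform :: "nat \<Rightarrow> nat \<Rightarrow> ((nat \<Rightarrow> 'a) \<Rightarrow> 'a) \<Rightarrow> bool" for d where
  const: "c \<in> carrier R \<Longrightarrow> hform d 0 (\<lambda>a. c)"
| zero: "hform d j (\<lambda>a. \<zero>)"
| add: "hform d j f \<Longrightarrow> hform d j g \<Longrightarrow> hform d j (\<lambda>a. f a \<oplus> g a)"
| smult: "c \<in> carrier R \<Longrightarrow> hform d j f \<Longrightarrow> hform d j (\<lambda>a. c \<otimes> f a)"
| var: "i < d \<Longrightarrow> hform d j f \<Longrightarrow> hform d (Suc j) (\<lambda>a. a i \<otimes> f a)"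

text \<open>Polynomial functions in Horner form; \<open>n\<close> only bounds the degree, and only
  values on the carrier are constrained.\<close>

primrec (in cring) upoly :: "nat \<Rightarrow> ('a \<Rightarrow> 'a) \<Rightarrow> bool" where
  "upoly 0 u \<longleftrightarrow> (\<exists>c\<in>carrier R. \<forall>t\<in>carrier R. u t = c)"
| "upoly (Suc n) u \<longleftrightarrow> (\<exists>c\<in>carrier R. \<exists>v. upoly n v \<and> (\<forall>t\<in>carrier R. u t = c \<oplus> t \<otimes> v t))"

context cring
begin

lemma hform_closed: "hform d j f \<Longrightarrow> (\<And>i. a i \<in> carrier R) \<Longrightarrow> f a \<in> carrier R"
  by (induct rule: hform.induct) auto

lemma hform_cong:
  "hform d j f \<Longrightarrow> (\<And>i. i < d \<Longrightarrow> a i = b i) \<Longrightarrow> f a = f b"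
  by (induct rule: hform.induct) auto

lemma hform_no_vars:
  "hform d j f \<Longrightarrow> d = 0 \<Longrightarrow> j > 0 \<Longrightarrow> f a = \<zero>"
  by (induct rule: hform.induct) auto

text \<open>A monomial either omits the last variable or is divisible by it. In degree 0 the
  cofactor would have degree -1, so it is fixed to be the zero function.\<close>

lemma hform_split_last:
  assumes "hform (Suc d) j f"
  shows "\<exists>g h. hform d j g \<and> (case j of 0 \<Rightarrow> h = (\<lambda>a. \<zero>) | Suc j' \<Rightarrow> hform (Suc d) j' h)
    \<and> (\<forall>a. (\<forall>i. a i \<in> carrier R) \<longrightarrow> f a = g a \<oplus> a d \<otimes> h a)"
  using assms
proof induct
  case (const c)
  show ?case
    by (rule exI[of _ "\<lambda>a. c"], rule exI[of _ "\<lambda>a. \<zero>"])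
      (use const in \<open>auto intro: hform.const\<close>)
next
  case (zero j)
  show ?case
    by (rule exI[of _ "\<lambda>a. \<zero>"], rule exI[of _ "\<lambda>a. \<zero>"])
      (auto intro: hform.zero split: nat.split)
next
  case (add j f f')
  then obtain g h g' h' where gh: "hform d j g" "hform d j g'"
    "case j of 0 \<Rightarrow> h = (\<lambda>a. \<zero>) | Suc j' \<Rightarrow> hform (Suc d) j' h"
    "case j of 0 \<Rightarrow> h' = (\<lambda>a. \<zero>) | Suc j' \<Rightarrow> hform (Suc d) j' h'"
    "\<And>a. (\<forall>i. a i \<in> carrier R) \<Longrightarrow> f a = g a \<oplus> a d \<otimes> h a"
    "\<And>a. (\<forall>i. a i \<in> carrier R) \<Longrightarrow> f' a = g' a \<oplus> a d \<otimes> h' a" by blast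
  have "f a \<oplus> f' a = (g a \<oplus> g' a) \<oplus> a d \<otimes> (h a \<oplus> h' a)" if a: "\<forall>i. a i \<in> carrier R" for a
  proof -
    have "h a \<in> carrier R" "h' a \<in> carrier R"
      using gh(3,4) a hform_closed[of "Suc d" _ h a] hform_closed[of "Suc d" _ h' a]
      by (auto split: nat.splits)
    moreover have "g a \<in> carrier R" "g' a \<in> carrier R" "a d \<in> carrier R"
      using a hform_closed gh(1,2) by auto
    ultimately show ?thesis unfolding gh(5)[OF a] gh(6)[OF a] by algebra
  qed
  then show ?case
    by - (rule exI[of _ "\<lambda>a. g a \<oplus> g' a"], rule exI[of _ "\<lambda>a. h a \<oplus> h' a"],
      use gh(1-4) in \<open>auto intro: hform.add split: nat.splits\<close>)
next
  case (smult c j f)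
  then obtain g h where gh: "hform d j g"
    "case j of 0 \<Rightarrow> h = (\<lambda>a. \<zero>) | Suc j' \<Rightarrow> hform (Suc d) j' h"
    "\<And>a. (\<forall>i. a i \<in> carrier R) \<Longrightarrow> f a = g a \<oplus> a d \<otimes> h a" by blast
  have "c \<otimes> f a = c \<otimes> g a \<oplus> a d \<otimes> (c \<otimes> h a)" if a: "\<forall>i. a i \<in> carrier R" for a
  proof -
    have "g a \<in> carrier R" "a d \<in> carrier R" "h a \<in> carrier R"
      using a hform_closed[OF gh(1)] gh(2) hform_closed[of "Suc d" _ h a]
      by (auto split: nat.splits)
    then show ?thesis unfolding gh(3)[OF a] using smult(1) by algebra
  qed
  then show ?case
    by - (rule exI[of _ "\<lambda>a. c \<otimes> g a"], rule exI[of _ "\<lambda>a. c \<otimes> h a"],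
      use gh(1,2) smult(1) in \<open>auto intro: hform.smult split: nat.splits\<close>)
next
  case (var i j f)
  then obtain g h where gh: "hform d j g"
    "case j of 0 \<Rightarrow> h = (\<lambda>a. \<zero>) | Suc j' \<Rightarrow> hform (Suc d) j' h"
    "\<And>a. (\<forall>i. a i \<in> carrier R) \<Longrightarrow> f a = g a \<oplus> a d \<otimes> h a" by blast
  show ?case
  proof (cases "i = d")
    case True
    then show ?thesis
      by - (rule exI[of _ "\<lambda>a. \<zero>"], rule exI[of _ f],
        use var(2) hform_closed[OF var(2)] in \<open>auto intro: hform.zero\<close>)
  next
    case False
    \<comment> \<open>The cofactor must have degree \<open>j\<close>. For \<open>j = 0\<close> the
      rule \<open>var\<close> cannot produce it, so the zero form is taken.\<close>
    define h' where "h' = (if j = 0 then (\<lambda>a. \<zero>) else (\<lambda>a. a i \<otimes> h a))"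
    have "a i \<otimes> f a = a i \<otimes> g a \<oplus> a d \<otimes> h' a" if a: "\<forall>i. a i \<in> carrier R" for a
    proof -
      have car: "g a \<in> carrier R" "a d \<in> carrier R" "a i \<in> carrier R" "h a \<in> carrier R"
        using a hform_closed[OF gh(1)] gh(2) hform_closed[of "Suc d" _ h a]
        by (auto split: nat.splits)
      moreover have "h' a = a i \<otimes> h a" using gh(2) car by (auto simp: h'_def)
      ultimately show ?thesis unfolding gh(3)[OF a] by (simp add: r_distr m_lcomm)
    qed
    moreover have "hform (Suc d) j h'"
      using gh(2) var(1) by (auto simp: h'_def intro: hform.intros split: nat.splits)
    moreover have "hform d (Suc j) (\<lambda>a. a i \<otimes> g a)"
      using False var(1) gh(1) by (intro hform.var) auto
    ultimately show ?thesis
      by - (rule exI[of _ "\<lambda>a. a i \<otimes> g a"], rule exI[of _ h'], auto)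
  qed
qed

section \<open>Polynomial functions in one variable, then values and congruences of forms\<close>

lemma upoly_closed: "upoly n u \<Longrightarrow> t \<in> carrier R \<Longrightarrow> u t \<in> carrier R"
  by (induct n arbitrary: u) auto

lemma upoly_zero: "upoly n (\<lambda>t. \<zero>)"
proof (induct n)
  case (Suc n)
  then show ?case by (auto intro!: bexI[of _ \<zero>] exI[of _ "\<lambda>t. \<zero>"])
qed auto

lemma upoly_Suc: "upoly n u \<Longrightarrow> upoly (Suc n) u"
proof (induct n arbitrary: u)
  case 0
  then obtain c where c: "c \<in> carrier R" "\<forall>t\<in>carrier R. u t = c" by auto
  have "upoly 0 (\<lambda>t. \<zero>)" by (rule upoly_zero)
  then show ?case
    unfolding upoly.simps(2)
    by - (rule bexI[OF _ c(1)], rule exI[of _ "\<lambda>t. \<zero>"], use c in auto)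
next
  case (Suc n)
  then obtain c v where "c \<in> carrier R" "upoly n v" "\<forall>t\<in>carrier R. u t = c \<oplus> t \<otimes> v t" by auto
  then show ?case using Suc.hyps[of v] upoly.simps(2)[of "Suc n" u] by blast
qed

lemma upoly_add: "upoly n u \<Longrightarrow> upoly n v \<Longrightarrow> upoly n (\<lambda>t. u t \<oplus> v t)"
proof (induct n arbitrary: u v)
  case 0
  then show ?case by auto
next
  case (Suc n)
  then obtain c u' e v' where c: "c \<in> carrier R" "upoly n u'" "\<And>t. t\<in>carrier R \<Longrightarrow> u t = c \<oplus> t \<otimes> u' t"
    and e: "e \<in> carrier R" "upoly n v'" "\<And>t. t\<in>carrier R \<Longrightarrow> v t = e \<oplus> t \<otimes> v' t" by auto
  have "u t \<oplus> v t = (c \<oplus> e) \<oplus> t \<otimes> (u' t \<oplus> v' t)" if t: "t \<in> carrier R" for t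
    unfolding c(3)[OF t] e(3)[OF t] using t c(1) e(1) upoly_closed[OF c(2) t] upoly_closed[OF e(2) t]
    by algebra
  then show ?case
    using Suc.hyps[OF c(2) e(2)] c(1) e(1)
    by (auto intro!: bexI[of _ "c \<oplus> e"] exI[of _ "\<lambda>t. u' t \<oplus> v' t"])
qed

lemma upoly_smult: "k \<in> carrier R \<Longrightarrow> upoly n u \<Longrightarrow> upoly n (\<lambda>t. k \<otimes> u t)"
proof (induct n arbitrary: u)
  case 0
  then show ?case by auto
next
  case (Suc n)
  then obtain c u' where c: "c \<in> carrier R" "upoly n u'" "\<And>t. t\<in>carrier R \<Longrightarrow> u t = c \<oplus> t \<otimes> u' t"
    by auto
  have "k \<otimes> u t = k \<otimes> c \<oplus> t \<otimes> (k \<otimes> u' t)" if t: "t \<in> carrier R" for t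
    unfolding c(3)[OF t] using t c(1) Suc.prems(1) upoly_closed[OF c(2) t] by algebra
  then show ?case
    using Suc.hyps[OF Suc.prems(1) c(2)] c(1) Suc.prems(1)
    by (auto intro!: bexI[of _ "k \<otimes> c"] exI[of _ "\<lambda>t. k \<otimes> u' t"])
qed

lemma upoly_mult_var: "upoly n u \<Longrightarrow> upoly (Suc n) (\<lambda>t. t \<otimes> u t)"
  using upoly_closed by (auto intro!: bexI[of _ \<zero>] exI[of _ u])

text \<open>Horner division: if u = c + t v and v = v(s) + (t - s) q, then u = u(s) + (t - s)(v + s
  q).\<close>

lemma upoly_divide:
  assumes "upoly (Suc n) u" "s \<in> carrier R"
  shows "\<exists>q. upoly n q \<and> (\<forall>t\<in>carrier R. u t = u s \<oplus> (t \<ominus> s) \<otimes> q t)"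
  using assms(1)
proof (induct n arbitrary: u)
  case 0
  then obtain c v where c: "c \<in> carrier R" "upoly 0 v" "\<And>t. t\<in>carrier R \<Longrightarrow> u t = c \<oplus> t \<otimes> v t"
    by auto
  then obtain b where b: "b \<in> carrier R" "\<And>t. t\<in>carrier R \<Longrightarrow> v t = b" by auto
  have "u t = u s \<oplus> (t \<ominus> s) \<otimes> b" if t: "t \<in> carrier R" for t
    unfolding c(3)[OF t] c(3)[OF assms(2)] b(2)[OF t] b(2)[OF assms(2)]
    using t c(1) b(1) assms(2) by algebra
  then show ?case using b(1) by (intro exI[of _ "\<lambda>t. b"]) auto
next
  case (Suc n)
  then obtain c v where c: "c \<in> carrier R" "upoly (Suc n) v"
    "\<And>t. t\<in>carrier R \<Longrightarrow> u t = c \<oplus> t \<otimes> v t" by (auto simp only: upoly.simps(2)[of "Suc n"])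
  obtain q where q: "upoly n q" "\<And>t. t\<in>carrier R \<Longrightarrow> v t = v s \<oplus> (t \<ominus> s) \<otimes> q t"
    using Suc.hyps[OF c(2)] by auto
  have "u t = u s \<oplus> (t \<ominus> s) \<otimes> (v t \<oplus> s \<otimes> q t)" if t: "t \<in> carrier R" for t
  proof -
    have "v s \<in> carrier R" "q t \<in> carrier R"
      using upoly_closed c(2) q(1) assms(2) t by auto
    then show ?thesis
      unfolding c(3)[OF t] c(3)[OF assms(2)] q(2)[OF t] using t c(1) assms(2) by algebra
  qed
  moreover have "upoly (Suc n) (\<lambda>t. v t \<oplus> s \<otimes> q t)"
    by (rule upoly_add[OF c(2) upoly_smult[OF assms(2) upoly_Suc[OF q(1)]]])
  ultimately show ?case by blast
qed

lemma hform_upoly: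
  assumes "hform d j f" "\<And>k. a k \<in> carrier R"
  shows "upoly j (\<lambda>t. f (a(i := t)))"
  using assms(1)
proof induct
  case (var k j f)
  show ?case
  proof (cases "k = i")
    case True
    then show ?thesis using upoly_mult_var[OF var(3)] by simp
  next
    case False
    then show ?thesis using upoly_smult[OF assms(2) upoly_Suc[OF var(3)]] by (simp del: upoly.simps)
  qed
qed (auto intro: upoly_add upoly_smult upoly_zero)

text \<open>In the domain R / P a root s splits off the factor t - s, and the quotient, of smaller
  degree, still vanishes on the infinite set \<open>Z - {s}\<close>.\<close>

lemma upoly_roots:
  assumes P: "primeideal P R" and u: "upoly n u"
    and Z: "infinite Z" "Z \<subseteq> carrier R" "\<And>s t. s \<in> Z \<Longrightarrow> t \<in> Z \<Longrightarrow> s \<noteq> t \<Longrightarrow> s \<ominus> t \<notin> P"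
    and roots: "\<And>t. t \<in> Z \<Longrightarrow> u t \<in> P" and t: "t \<in> carrier R"
  shows "u t \<in> P"
  using u Z roots t
proof (induct n arbitrary: u Z t)
  case 0
  then obtain s where "s \<in> Z" using infinite_imp_nonempty by blast
  moreover from this have "u t = u s" using 0(1,3,6) by auto
  ultimately show ?case using 0(5) by simp
next
  case (Suc n)
  then obtain s where s: "s \<in> Z" using infinite_imp_nonempty by blast
  then have sc: "s \<in> carrier R" using Suc.prems by blast
  obtain q where q: "upoly n q" "\<And>t. t\<in>carrier R \<Longrightarrow> u t = u s \<oplus> (t \<ominus> s) \<otimes> q t"
    using upoly_divide[OF Suc.prems(1) sc] by blast
  have P': "ideal P R" using P by (rule primeideal.axioms(1))
  have usP: "u s \<in> P" using Suc.prems(5) s by blast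
  have usc: "u s \<in> carrier R" by (rule ideal.Icarr[OF P' usP])
  have "q r \<in> P" if r: "r \<in> Z - {s}" for r
  proof -
    have rc: "r \<in> carrier R" using r Suc.prems by blast
    have qc: "q r \<in> carrier R" using upoly_closed[OF q(1) rc] .
    have "u r \<ominus> u s \<in> P" using ideal_diff[OF P'] Suc.prems(5) r usP by blast
    moreover have "u r \<ominus> u s = (r \<ominus> s) \<otimes> q r"
      unfolding q(2)[OF rc] using rc sc qc usc by algebra
    moreover have "r \<ominus> s \<notin> P" using Suc.prems(4)[of r s] r s by blast
    ultimately show ?thesis using primeideal.I_prime[OF P, of "r \<ominus> s" "q r"] rc sc qc by auto
  qed
  then have "q t \<in> P"
    using Suc.hyps[OF q(1), of "Z - {s}" t] Suc.prems by auto
  then show ?case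
    unfolding q(2)[OF Suc.prems(6)] using usP Suc.prems(6) sc
    by (intro ideal_add[OF P'] ideal.I_l_closed[OF P']) auto
qed

text \<open>If u = f(y) and v is the sum of the r_k y_k, then uv is the value at y of the form with
  terms r_k a_k f(a). The inner induction builds this sum one generator at a time.\<close>

lemma ideal_power_hform:
  assumes y: "\<And>i. y i \<in> carrier R" and u: "u \<in> ideal_power R (Idl (y ` {..<d})) j"
  shows "\<exists>f. hform d j f \<and> f y = u"
  using u
proof (induct j arbitrary: u)
  case 0
  then have "u \<in> carrier R" by (simp only: ideal_power_0_Suc)
  then show ?case using hform.const[of u d] by blast
next
  case (Suc j)
  have I: "ideal (Idl (y ` {..<d})) R" using y by (intro genideal_ideal) auto
  from Suc.prems have "u \<in> ideal_prod R (ideal_power R (Idl (y ` {..<d})) j) (Idl (y ` {..<d}))"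
    by (simp only: ideal_power_0_Suc)
  then show ?case
  proof induct
    case (prod u v)
    obtain f where f: "hform d j f" "f y = u" using Suc.hyps[OF prod(1)] by blast
    have uc: "u \<in> carrier R" by (rule ideal.Icarr[OF ideal_power_ideal[OF I] prod(1)])
    have "\<exists>g. hform d (Suc j) g \<and> g y = u \<otimes> v" if "v \<in> Idl (y ` {..<k})" "k \<le> d" for k
      using that
    proof (induct k arbitrary: v)
      case 0
      then have "v = \<zero>" by (simp add: genideal_empty)
      then show ?case using hform.zero[of d "Suc j"] uc by (intro exI[of _ "\<lambda>a. \<zero>"]) auto
    next
      case (Suc k)
      have "v \<in> Idl (insert (y k) (y ` {..<k}))" using Suc.prems(1) by (simp add: lessThan_Suc)
      then obtain r e where re: "r \<in> carrier R" "e \<in> Idl (y ` {..<k})" "v = r \<otimes> y k \<oplus> e"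
        using y by (elim genideal_insertE) auto
      obtain g where g: "hform d (Suc j) g" "g y = u \<otimes> e" using Suc.hyps[OF re(2)] Suc.prems(2) by auto
      have ec: "e \<in> carrier R" using re(2) y by (intro ideal.Icarr[OF genideal_ideal re(2)]) auto
      have "u \<otimes> v = r \<otimes> (y k \<otimes> u) \<oplus> u \<otimes> e" using re(1) y[of k] ec uc unfolding re(3) by algebra
      then have "r \<otimes> (y k \<otimes> f y) \<oplus> g y = u \<otimes> v" using f g by simp
      moreover have "hform d (Suc j) (\<lambda>a. r \<otimes> (a k \<otimes> f a) \<oplus> g a)"
        using Suc.prems(2) f(1) g(1) re(1) by (intro hform.add hform.smult hform.var) auto
      ultimately show ?case by (intro exI[of _ "\<lambda>a. r \<otimes> (a k \<otimes> f a) \<oplus> g a"]) auto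
    qed
    from this[of d] prod(2) show ?case by blast
  next
    case (sum a b)
    then obtain f g where "hform d (Suc j) f" "f y = a" "hform d (Suc j) g" "g y = b" by blast
    then show ?case using hform.add by (intro exI[of _ "\<lambda>x. f x \<oplus> g x"]) auto
  qed
qed

text \<open>Modulo \<open>L\<close> the point y is the multiple of a by \<open>w\<close>, and
  homogeneity pulls out w^j.\<close>

lemma hform_cong_ideal:
  assumes "hform d j f" and L: "ideal L R" and y: "\<And>i. y i \<in> carrier R" and a: "\<And>i. a i \<in> carrier R"
    and w: "w \<in> carrier R" and cong: "\<And>i. i < d \<Longrightarrow> y i \<ominus> a i \<otimes> w \<in> L"
  shows "f y \<ominus> f a \<otimes> w [^] j \<in> L"
  using assms(1)
proof induct
  case (const c)
  then have "c \<ominus> c \<otimes> w [^] (0::nat) = \<zero>" by simp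
  then show ?case using ideal_zero[OF L] by simp
next
  case (zero j)
  have "\<zero> \<ominus> \<zero> \<otimes> w [^] j = \<zero>" using w by (simp add: a_minus_def)
  then show ?case using ideal_zero[OF L] by simp
next
  case (add j f g)
  have c: "f y \<in> carrier R" "g y \<in> carrier R" "f a \<in> carrier R" "g a \<in> carrier R" "w [^] j \<in> carrier R"
    using add(1,3) hform_closed y a w by auto
  then have "f y \<oplus> g y \<ominus> (f a \<oplus> g a) \<otimes> w [^] j
    = (f y \<ominus> f a \<otimes> w [^] j) \<oplus> (g y \<ominus> g a \<otimes> w [^] j)" by algebra
  then show ?case using ideal_add[OF L add(2,4)] by simp
next
  case (smult c j f)
  have "f y \<in> carrier R" "f a \<in> carrier R" "w [^] j \<in> carrier R"
    using smult(2) hform_closed y a w by auto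
  then have "c \<otimes> f y \<ominus> (c \<otimes> f a) \<otimes> w [^] j = c \<otimes> (f y \<ominus> f a \<otimes> w [^] j)"
    using smult(1) by algebra
  then show ?case using ideal.I_l_closed[OF L smult(3,1)] by simp
next
  case (var i j f)
  have c: "f y \<in> carrier R" "f a \<in> carrier R" "w [^] j \<in> carrier R" "y i \<in> carrier R" "a i \<in> carrier R"
    using var(2) hform_closed y a w by auto
  then have "y i \<otimes> f y \<ominus> (a i \<otimes> f a) \<otimes> (w [^] j \<otimes> w)
    = f y \<otimes> (y i \<ominus> a i \<otimes> w) \<oplus> (a i \<otimes> w) \<otimes> (f y \<ominus> f a \<otimes> w [^] j)"
    using w by algebra
  also have "\<dots> \<in> L" using c w var(3) cong[OF var(1)]
    by (simp add: ideal_add[OF L] ideal.I_l_closed[OF L])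
  finally show ?case by simp
qed

end

section \<open>Infinite residue fields\<close>

context noetherian_local_ring
begin

text \<open>One representative is chosen per residue class; at most one of them lies in
  \<open>m\<close>, and discarding it leaves only units.\<close>

lemma infinite_incongruent:
  assumes "infinite (carrier (R Quot m))"
  obtains Z where "infinite Z" "Z \<subseteq> carrier R" "Z \<inter> m = {}"
    "\<And>s t. s \<in> Z \<Longrightarrow> t \<in> Z \<Longrightarrow> s \<noteq> t \<Longrightarrow> s \<ominus> t \<notin> m"
proof -
  have "carrier (R Quot m) = (\<lambda>a. m +> a) ` carrier R"
    by (auto simp: FactRing_def A_RCOSETS_def')
  then obtain Z where Z: "Z \<subseteq> carrier R" "inj_on (\<lambda>a. m +> a) Z"
    "carrier (R Quot m) = (\<lambda>a. m +> a) ` Z"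
    using subset_image_inj[of "carrier (R Quot m)" "\<lambda>a. m +> a" "carrier R"] by auto
  have inf: "infinite Z" using assms Z(3) by auto
  have diff: "s \<ominus> t \<notin> m" if "s \<in> Z" "t \<in> Z" "s \<noteq> t" for s t
    using quotient_eq_iff_same_a_r_cos[OF is_ideal, of s t] that Z(1,2) by (auto dest: inj_onD)
  have "Z \<inter> m \<subseteq> {s}" if "s \<in> Z \<inter> m" for s
    using diff[of s] ideal_diff[OF is_ideal, of s] that by auto
  then have "finite (Z \<inter> m)" by (metis finite.emptyI finite_insert finite_subset equals0I)
  then have "infinite (Z - m)" using inf by (metis Diff_Diff_Int finite_Diff2 finite_Diff Diff_infinite_finite)
  then show ?thesis using that[of "Z - m"] Z(1) diff by blast
qed

text \<open>Where the i-th coordinate runs through \<open>Z\<close>, the factor \<open>a i\<close>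
  is outside the prime \<open>m\<close> and cancels. As a polynomial in that coordinate,
  \<open>f\<close> then has infinitely many incongruent roots modulo \<open>m\<close>, so it also
  vanishes where \<open>a i\<close> lies in \<open>m\<close>.\<close>

lemma hform_var_cancel:
  assumes inf: "infinite (carrier (R Quot m))" and f: "hform d j f"
    and van: "\<And>a. (\<And>k. a k \<in> carrier R) \<Longrightarrow> a i \<otimes> f a \<in> m"
    and a: "\<And>k. a k \<in> carrier R"
  shows "f a \<in> m"
proof -
  obtain Z where Z: "infinite Z" "Z \<subseteq> carrier R" "Z \<inter> m = {}"
    "\<And>s t. s \<in> Z \<Longrightarrow> t \<in> Z \<Longrightarrow> s \<noteq> t \<Longrightarrow> s \<ominus> t \<notin> m"
    using infinite_incongruent[OF inf] by blast
  define u where "u = (\<lambda>t. f (a(i := t)))"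
  have "upoly j u" unfolding u_def by (rule hform_upoly[OF f a])
  moreover have "u t \<in> m" if t: "t \<in> Z" for t
  proof -
    have c: "(a(i := t)) k \<in> carrier R" for k using t Z(2) a by auto
    have "t \<otimes> u t \<in> m" using van[of "a(i := t)", OF c] by (simp add: u_def)
    moreover have "u t \<in> carrier R" unfolding u_def by (rule hform_closed[OF f c])
    ultimately show ?thesis using primeideal.I_prime[OF m_prime, of t "u t"] t Z(2,3) by auto
  qed
  ultimately have "u (a i) \<in> m" using upoly_roots[OF m_prime _ Z(1,2,4)] a by blast
  then show ?thesis by (simp add: u_def)
qed

text \<open>Split f = g + a_d h. Setting a_d to zero shows that \<open>g\<close> vanishes modulo
  \<open>m\<close>; hence a_d h does, and cancelling a_d, so does \<open>h\<close>. Induction on the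
  number of variables handles \<open>g\<close>, induction on the degree handles \<open>h\<close>,
  and the factor y_d restores the missing order.\<close>

lemma hform_vanishing:
  assumes inf: "infinite (carrier (R Quot m))" and "hform d j f"
    and "\<And>a. (\<And>k. a k \<in> carrier R) \<Longrightarrow> f a \<in> m"
    and y: "\<And>i. y i \<in> m"
  shows "f y \<in> ideal_power R m (Suc j)"
  using assms(2,3)
proof (induct d arbitrary: j f)
  case 0
  have yc: "y k \<in> carrier R" for k using y ideal.Icarr[OF is_ideal] by blast
  show ?case
  proof (cases j)
    case 0
    then show ?thesis using "0.prems"(2)[of y, OF yc] unfolding 0 ideal_power_1[OF is_ideal] by simp
  next
    case (Suc j')
    then have "f y = \<zero>" using "0.prems"(1) hform_no_vars by blast
    then show ?thesis using ideal_zero[OF ideal_power_ideal[OF is_ideal]] by (simp only:)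
  qed
next
  case (Suc d)
  have yc: "y k \<in> carrier R" for k using y ideal.Icarr[OF is_ideal] by blast
  note IH = Suc.hyps
  show ?case using Suc.prems
  proof (induct j arbitrary: f)
    case 0
    then show ?case using "0.prems"(2)[of y, OF yc] unfolding ideal_power_1[OF is_ideal] by simp
  next
    case (Suc j)
    obtain g h where gh: "hform d (Suc j) g" "hform (Suc d) j h"
      "\<And>a. (\<And>i. a i \<in> carrier R) \<Longrightarrow> f a = g a \<oplus> a d \<otimes> h a"
      using hform_split_last[OF Suc.prems(1)] by auto
    have gm: "g a \<in> m" if a: "\<And>k. a k \<in> carrier R" for a
    proof -
      have c: "(a(d := \<zero>)) k \<in> carrier R" for k using a by simp
      have "g a = g (a(d := \<zero>))" by (rule hform_cong[OF gh(1)]) simp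
      also have "\<dots> = f (a(d := \<zero>))"
        using gh(3)[of "a(d := \<zero>)", OF c] hform_closed[OF gh(1), of "a(d := \<zero>)", OF c]
          hform_closed[OF gh(2), of "a(d := \<zero>)", OF c] by simp
      finally show ?thesis using Suc.prems(2)[of "a(d := \<zero>)", OF c] by (simp only:)
    qed
    have "a d \<otimes> h a \<in> m" if a: "\<And>k. a k \<in> carrier R" for a
    proof -
      have "f a \<ominus> g a \<in> m" using ideal_diff[OF is_ideal Suc.prems(2) gm] a by blast
      moreover have "g a \<in> carrier R" "h a \<in> carrier R"
        using hform_closed gh(1,2) a by auto
      then have "f a \<ominus> g a = a d \<otimes> h a" unfolding gh(3)[of a, OF a] using a[of d] by algebra
      ultimately show ?thesis by simp
    qed
    then have "h a \<in> m" if "\<And>k. a k \<in> carrier R" for a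
      using hform_var_cancel[OF inf gh(2)] that by blast
    then have "h y \<in> ideal_power R m (Suc j)" using Suc.hyps[OF gh(2)] by blast
    then have "y d \<otimes> h y \<in> ideal_power R m (Suc (Suc j))"
      using ideal_power_mult_mem[OF is_ideal, of "y d" "Suc 0" "h y" "Suc j"] y[of d]
      unfolding ideal_power_1[OF is_ideal] by simp
    moreover have "g y \<in> ideal_power R m (Suc (Suc j))" using IH[OF gh(1)] gm by blast
    ultimately show ?case
      unfolding gh(3)[of y, OF yc] by (intro ideal_add ideal_power_ideal is_ideal)
  qed
qed

end


section \<open>Regular local rings\<close>

context regular_local_ring
begin

abbreviation emb_dim :: nat where "emb_dim \<equiv> min_gens R m"

lemma minimal_generators:
  obtains S where "S \<subseteq> m" "finite S" "card S = emb_dim" "m = Idl S"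
proof -
  obtain A where "A \<subseteq> carrier R" "finite A" "m = Idl A" using finetely_gen[OF is_ideal] by blast
  then have "\<exists>n. \<exists>S\<subseteq>carrier R. finite S \<and> card S = n \<and> m = Idl S" by blast
  from LeastI_ex[OF this] obtain S
    where "S \<subseteq> carrier R" "finite S" "card S = emb_dim" "m = Idl S"
    unfolding min_gens_def by blast
  then show ?thesis using that genideal_self by blast
qed

text \<open>A finite positive supremum of natural numbers is attained, so the dimension is the
  length of an actual chain.\<close>

lemma long_prime_chain:
  assumes "emb_dim > 0"
  obtains P where "prime_chain emb_dim P" "P emb_dim = m"
proof -
  define X where "X = {enat n | n. \<exists>P. (\<forall>i\<le>n. primeideal (P i) R) \<and> (\<forall>i<n. P i \<subset> P (Suc i))}"
  have X: "Sup X = enat emb_dim" using regular unfolding krull_dim_def X_def .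
  have "enat emb_dim \<in> X"
  proof (rule ccontr)
    assume no: "enat emb_dim \<notin> X"
    have "x \<le> enat (emb_dim - 1)" if x: "x \<in> X" for x
    proof -
      have "x \<le> enat emb_dim" using Sup_upper[OF x] X by simp
      moreover have "x \<noteq> enat emb_dim" using no x by auto
      ultimately show ?thesis by (cases x) auto
    qed
    then have "enat emb_dim \<le> enat (emb_dim - 1)" using Sup_least[of X] X by metis
    then show False using assms by simp
  qed
  then obtain P where P: "\<forall>i\<le>emb_dim. primeideal (P i) R" "\<forall>i<emb_dim. P i \<subset> P (Suc i)"
    unfolding X_def by auto
  have "P emb_dim \<subseteq> m"
    using P(1) proper_ideal_subset[of "P emb_dim"] primeideal.axioms(1)[of "P emb_dim" R]
      primeideal.I_notcarr[of "P emb_dim" R] by auto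
  then have "P i \<subset> m" if "Suc i = emb_dim" for i
    using P(2) that by (metis lessI psubset_subset_trans)
  \<comment> \<open>Every prime lies in \<open>m\<close>, so replacing the top prime by
    \<open>m\<close> keeps the last inclusion strict.\<close>
  then have "prime_chain emb_dim (P(emb_dim := m))"
    using P m_prime unfolding prime_chain_def by simp
  then show ?thesis using that by simp
qed

text \<open>The height theorem yields a prime strictly below \<open>m\<close> containing
  \<open>Y\<close>; it cannot contain a power of \<open>m\<close>. Equality of dimension and
  embedding dimension enters the later arguments only through this fact.\<close>

lemma few_elements_not_primary:
  assumes "finite Y" "Y \<subseteq> m" "card Y < emb_dim"
  shows "\<not> ideal_power R m n \<subseteq> Idl Y"
proof
  assume sub: "ideal_power R m n \<subseteq> Idl Y"
  obtain P where P: "prime_chain emb_dim P" "P emb_dim = m" using long_prime_chain assms(3) by auto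
  obtain ys where ys: "set ys = Y" "distinct ys" using finite_distinct_list[OF assms(1)] by blast
  then have "length ys < emb_dim" using assms(3) distinct_card by fastforce
  then obtain Q where Q: "primeideal Q R" "Q \<subset> m" "Y \<subseteq> Q"
    using height_theorem[OF P(1), of ys] P(2) ys(1) assms(2) by auto
  have "ideal_power R m n \<subseteq> Q"
    using sub genideal_minimal[OF primeideal.axioms(1)[OF Q(1)] Q(3)] by blast
  then have "m \<subseteq> Q" by (rule prime_power_subset[OF Q(1) is_ideal])
  then show False using Q(2) by blast
qed

lemma indexed_generators:
  assumes "emb_dim > 0"
  obtains y e where "emb_dim = Suc e" "\<And>i. y i \<in> m" "m = Idl (y ` {..<Suc e})"
proof -
  obtain S where S: "S \<subseteq> m" "finite S" "card S = emb_dim" "m = Idl S"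
    by (rule minimal_generators)
  obtain h where h: "bij_betw h {0..<card S} S" using ex_bij_betw_nat_finite[OF S(2)] by blast
  \<comment> \<open>The default zero keeps all coordinates in \<open>m\<close>, since points are
    total functions.\<close>
  define y where "y i = (if i < emb_dim then h i else \<zero>)" for i
  have im: "y ` {..<emb_dim} = S"
    using h S(3) by (auto simp: y_def bij_betw_def atLeast0LessThan)
  have "y i \<in> m" for i using im S(1) ideal_zero[OF is_ideal] by (cases "i < emb_dim") (auto simp: y_def)
  moreover obtain e where "emb_dim = Suc e" using assms by (cases emb_dim) auto
  ultimately show ?thesis using that[of e y] im S(4) by auto
qed

text \<open>Specializing the variables to a point at which \<open>f\<close> does not vanish collapses \<open>m\<close> to a principal
  ideal modulo the \<open>e\<close> elements generating \<open>L\<close>; if \<open>f y\<close> had too high an order, \<open>L\<close> would contain a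
  power of \<open>m\<close>.\<close>

lemma hform_order:
  assumes d: "emb_dim = Suc e" and y: "\<And>i. y i \<in> m" and gen: "m = Idl (y ` {..<Suc e})"
    and f: "hform (Suc e) j f" and a: "\<And>k. a k \<in> carrier R" and ae: "a e \<notin> m" and fa: "f a \<notin> m"
  shows "f y \<notin> ideal_power R m (Suc j)"
proof
  assume fy: "f y \<in> ideal_power R m (Suc j)"
  have yc: "y k \<in> carrier R" for k using y ideal.Icarr[OF is_ideal] by blast
  have u: "a e \<in> Units R" using notin_maximal_Units a ae by blast
  \<comment> \<open>Chosen so that a_e w = y_e: the congruence at index e is an equality, and only e
    elements are needed to generate \<open>L\<close>.\<close>
  define w where "w = inv (a e) \<otimes> y e"
  have w: "w \<in> m" unfolding w_def using u by (simp add: y I_l_closed)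
  have wc: "w \<in> carrier R" by (rule ideal.Icarr[OF is_ideal w])
  have aw: "a e \<otimes> w = y e" unfolding w_def using u yc a by (simp add: m_assoc[symmetric])
  define Y where "Y = (\<lambda>k. y k \<ominus> a k \<otimes> w) ` {..<e}"
  have Ym: "Y \<subseteq> m" unfolding Y_def using y w a by (auto intro!: ideal_diff[OF is_ideal] I_l_closed)
  then have Yc: "Y \<subseteq> carrier R" using a_subset by blast
  have L: "ideal (Idl Y) R" by (rule genideal_ideal[OF Yc])
  have cong: "y k \<ominus> a k \<otimes> w \<in> Idl Y" if k: "k < Suc e" for k
  proof (cases "k = e")
    case True
    have "y e \<ominus> y e = \<zero>" using yc by (simp add: a_minus_def r_neg)
    then show ?thesis using True aw ideal_zero[OF L] by simp
  next
    case False
    then have "y k \<ominus> a k \<otimes> w \<in> Y" using k by (auto simp: Y_def)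
    then show ?thesis using genideal_self[OF Yc] by blast
  qed
  have K: "ideal (Idl Y <+> ideal_power R m (Suc j)) R" (is "ideal ?K R")
    by (intro add_ideals L ideal_power_ideal is_ideal)
  note up = set_add_upper[OF L ideal_power_ideal[OF is_ideal, of "Suc j"]]
  have fyc: "f y \<in> carrier R" and fac: "f a \<in> carrier R" and wjc: "w [^] j \<in> carrier R"
    using hform_closed[OF f] yc a wc by auto
  have "f y \<ominus> f a \<otimes> w [^] j \<in> Idl Y" by (rule hform_cong_ideal[OF f L yc a wc cong])
  then have "f y \<ominus> f a \<otimes> w [^] j \<in> ?K" "f y \<in> ?K" using fy up by blast+
  then have "f y \<ominus> (f y \<ominus> f a \<otimes> w [^] j) \<in> ?K" by (rule ideal_diff[OF K, rotated])
  moreover have "f y \<ominus> (f y \<ominus> f a \<otimes> w [^] j) = f a \<otimes> w [^] j" using fyc fac wjc by algebra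
  \<comment> \<open>Since f(a) is a unit, f(y) in m^(j+1) forces w^j into L + m^(j+1). Every other
    element g(y) of m^j is congruent to g(a) w^j modulo \<open>L\<close> and follows.\<close>
  ultimately have wK: "w [^] j \<in> ?K" using unit_cancel_mem[OF K fac fa wjc] by simp
  have "ideal_power R m j \<subseteq> ?K"
  proof
    fix v assume "v \<in> ideal_power R m j"
    then obtain g where g: "hform (Suc e) j g" "g y = v"
      using ideal_power_hform[of y v "Suc e" j, OF yc] unfolding gen[symmetric] by blast
    have "v \<ominus> g a \<otimes> w [^] j \<in> ?K"
      using hform_cong_ideal[OF g(1) L yc a wc cong] up g(2) by auto
    moreover have gc: "g a \<in> carrier R" "v \<in> carrier R" using hform_closed[OF g(1)] a yc g(2) by auto
    then have "g a \<otimes> w [^] j \<in> ?K" using wK by (intro ideal.I_l_closed[OF K])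
    ultimately have "(v \<ominus> g a \<otimes> w [^] j) \<oplus> g a \<otimes> w [^] j \<in> ?K" by (rule ideal_add[OF K])
    moreover have "(v \<ominus> g a \<otimes> w [^] j) \<oplus> g a \<otimes> w [^] j = v" using gc wjc by algebra
    ultimately show "v \<in> ?K" by simp
  qed
  then have "ideal_power R m j \<subseteq> Idl Y" by (rule nakayama_power[OF L])
  moreover have "card Y < emb_dim"
    using card_image_le[of "{..<e}" "\<lambda>k. y k \<ominus> a k \<otimes> w"] d by (simp add: Y_def)
  moreover have "finite Y" by (simp add: Y_def)
  ultimately show False using few_elements_not_primary Ym by blast
qed

lemma exists_superficial:
  assumes inf: "infinite (carrier (R Quot m))" and d: "emb_dim > 0"
  obtains x where "x \<in> m" "x \<notin> ideal_power R m (Suc (Suc 0))"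
    "\<And>n r. r \<in> carrier R \<Longrightarrow> r \<otimes> x \<in> ideal_power R m (Suc n) \<Longrightarrow> r \<in> ideal_power R m n"
proof -
  obtain y e where y: "emb_dim = Suc e" "\<And>i. y i \<in> m" "m = Idl (y ` {..<Suc e})"
    using indexed_generators[OF d] by metis
  have yc: "y k \<in> carrier R" for k using y(2) ideal.Icarr[OF is_ideal] by blast
  \<comment> \<open>The linear form a_e at the point with all coordinates one has value one, so y_e
    is outside m^2.\<close>
  have "hform (Suc e) (Suc 0) (\<lambda>a. a e \<otimes> \<one>)" by (intro hform.var hform.const) auto
  from hform_order[OF y this, of "\<lambda>_. \<one>"] prime_one_compl[OF m_prime]
  have x2: "y e \<notin> ideal_power R m (Suc (Suc 0))" using yc by simp
  have "r \<in> ideal_power R m n" if "r \<in> carrier R" "r \<otimes> y e \<in> ideal_power R m (Suc n)" for r n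
    using that
  proof (induct n)
    case 0
    then show ?case by (simp only: ideal_power_0_Suc)
  next
    case (Suc n)
    then have "r \<in> ideal_power R m n"
      using ideal_power_antimono[OF is_ideal, of "Suc n" "Suc (Suc n)"] by auto
    then obtain f where f: "hform (Suc e) n f" "f y = r"
      using ideal_power_hform[of y r "Suc e" n, OF yc] unfolding y(3)[symmetric] by blast
    show ?case
    proof (rule ccontr)
      assume no: "r \<notin> ideal_power R m (Suc n)"
      \<comment> \<open>If no such point existed, cancelling a_e would make \<open>f\<close> vanish
        modulo \<open>m\<close>, and r = f(y) would lie in m^(n+1).\<close>
      have "\<exists>a. (\<forall>k. a k \<in> carrier R) \<and> a e \<otimes> f a \<notin> m"
      proof (rule ccontr)
        assume "\<not> ?thesis"
        then have "f a \<in> m" if "\<And>k. a k \<in> carrier R" for a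
          using hform_var_cancel[OF inf f(1), of e a] that by blast
        then have "f y \<in> ideal_power R m (Suc n)"
          by (rule hform_vanishing[OF inf f(1) _ y(2)])
        then show False using f(2) no by simp
      qed
      then obtain a where a: "\<And>k. a k \<in> carrier R" "a e \<otimes> f a \<notin> m" by blast
      have "f a \<in> carrier R" by (rule hform_closed[OF f(1) a(1)])
      then have "a e \<notin> m" using a(2) I_r_closed[of "a e" "f a"] by blast
      moreover have "hform (Suc e) (Suc n) (\<lambda>a. a e \<otimes> f a)" using f(1) by (intro hform.var) auto
      ultimately have "y e \<otimes> f y \<notin> ideal_power R m (Suc (Suc n))"
        using hform_order[OF y, of "Suc n" "\<lambda>a. a e \<otimes> f a" a] a by blast
      then show False using Suc.prems f(2) m_comm yc by simp
    qed
  qed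
  then show ?thesis using that[of "y e"] y(2) x2 by blast
qed

text \<open>A proper \<open>I + m\<^sup>2\<close> lies in \<open>L + m\<^sup>2\<close> with \<open>L\<close> generated by fewer than \<open>dim R\<close> elements, and then
  a power of \<open>m\<close> lies in \<open>L\<close>.\<close>

lemma reduction_eq:
  assumes I: "reduction R m I"
  shows "I = m"
proof (rule ccontr)
  assume ne: "I \<noteq> m"
  obtain r where Ii: "ideal I R" "I \<subseteq> m"
    and r: "ideal_prod R I (ideal_power R m r) = ideal_power R m (Suc r)"
    using I unfolding reduction_def by auto
  have m2: "ideal (ideal_prod R m m) R" by (rule ideal_prod_is_ideal[OF is_ideal is_ideal])
  have Im2: "ideal (I <+> ideal_prod R m m) R" by (rule add_ideals[OF Ii(1) m2])
  \<comment> \<open>A maximal member of this family corresponds to a hyperplane in m / m^2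
    containing the image of \<open>I\<close>.\<close>
  define F where "F = {L. ideal L R \<and> I <+> ideal_prod R m m \<subseteq> L \<and> L \<subset> m}"
  have "I <+> ideal_prod R m m \<subseteq> m"
    using Ii(2) ideal_prod_inter[OF is_ideal is_ideal] by (intro set_add_subset[OF is_ideal]) auto
  moreover have "I <+> ideal_prod R m m \<noteq> m"
    using nakayama[OF Ii(1) is_ideal] Ii(2) ne by auto
  ultimately have "I <+> ideal_prod R m m \<in> F" using Im2 by (auto simp: F_def)
  then have "F \<noteq> {}" by blast
  then obtain L where L: "L \<in> F" "\<And>X. X \<in> F \<Longrightarrow> L \<subseteq> X \<Longrightarrow> X = L"
    by (rule ex_maximal_ideal) (auto simp: F_def)
  then have Li: "ideal L R" and Lm: "L \<subset> m" and IL: "I \<subseteq> L" and mL: "ideal_prod R m m \<subseteq> L"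
    using set_add_upper[OF Ii(1) m2] by (auto simp: F_def)
  obtain S where S: "S \<subseteq> m" "finite S" "card S = emb_dim" "m = Idl S"
    by (rule minimal_generators)
  obtain w where w: "w \<in> S" "w \<notin> L" using genideal_minimal[OF Li, of S] S(4) Lm by blast
  have wm: "w \<in> m" using w S(1) by blast
  have wc: "w \<in> carrier R" by (rule ideal.Icarr[OF is_ideal wm])
  have wi: "ideal (PIdl w) R" by (rule cgenideal_ideal[OF wc])
  have Lw: "L <+> PIdl w = m"
  proof (rule ccontr)
    assume "L <+> PIdl w \<noteq> m"
    moreover have "L <+> PIdl w \<subseteq> m"
      using Lm cgenideal_minimal[OF is_ideal wm] by (intro set_add_subset[OF is_ideal]) auto
    moreover note up = set_add_upper[OF Li wi]
    ultimately have "L <+> PIdl w \<in> F" using L(1) add_ideals[OF Li wi] by (auto simp: F_def)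
    then have "L <+> PIdl w = L" using L(2) up by blast
    then show False using up cgenideal_self[OF wc] w(2) by blast
  qed
  have "\<exists>l c. l \<in> L \<and> c \<in> carrier R \<and> s = l \<oplus> c \<otimes> w" if "s \<in> S" for s
  proof -
    have "s \<in> L <+> PIdl w" using that S(1) Lw by blast
    then show ?thesis by (elim set_add_memE) (auto simp: cgenideal_def)
  qed
  then obtain l c where lc: "\<And>s. s \<in> S \<Longrightarrow> l s \<in> L" "\<And>s. s \<in> S \<Longrightarrow> c s \<in> carrier R"
    "\<And>s. s \<in> S \<Longrightarrow> s = l s \<oplus> c s \<otimes> w" by metis
  \<comment> \<open>Together with \<open>w\<close>, the components in \<open>L\<close> of the
    remaining generators still generate \<open>m\<close>; without \<open>w\<close> there are fewer
    than \<open>emb_dim\<close> of them.\<close>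
  define Y where "Y = l ` (S - {w})"
  have YL: "Y \<subseteq> L" using lc(1) by (auto simp: Y_def)
  have Ym: "Y \<subseteq> m" using YL Lm by blast
  have Yc: "Y \<subseteq> carrier R" using Ym a_subset by blast
  have Yi: "ideal (Idl Y) R" by (rule genideal_ideal[OF Yc])
  have "card (S - {w}) < emb_dim" using w(1) S(2,3) by (metis card_Diff1_less)
  then have cardY: "card Y < emb_dim"
    using card_image_le[of "S - {w}" l] S(2) by (simp add: Y_def)
  have wYc: "insert w Y \<subseteq> carrier R" using Yc wc by auto
  have wYi: "ideal (Idl (insert w Y)) R" by (rule genideal_ideal[OF wYc])
  note wY = genideal_self[OF wYc]
  have "S \<subseteq> Idl (insert w Y)"
  proof
    fix s assume s: "s \<in> S"
    show "s \<in> Idl (insert w Y)"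
    proof (cases "s = w")
      case False
      then have "l s \<in> Idl (insert w Y)" using s wY by (auto simp: Y_def)
      moreover have "c s \<otimes> w \<in> Idl (insert w Y)"
        using lc(2)[OF s] wY by (intro ideal.I_l_closed[OF wYi]) auto
      ultimately show ?thesis using lc(3)[OF s] ideal_add[OF wYi] by metis
    qed (use wY in auto)
  qed
  then have mwY: "m \<subseteq> Idl (insert w Y)" using genideal_minimal[OF wYi] S(4) by blast
  \<comment> \<open>A unit coefficient at \<open>w\<close> would put \<open>w\<close> into
    \<open>L\<close>.\<close>
  have Ldec: "\<exists>p\<in>Idl Y. \<exists>q\<in>m. v = q \<otimes> w \<oplus> p" if v: "v \<in> L" for v
  proof -
    have "v \<in> Idl (insert w Y)" using v Lm mwY by blast
    then obtain q p where pq: "q \<in> carrier R" "p \<in> Idl Y" "v = q \<otimes> w \<oplus> p"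
      by (rule genideal_insertE[OF _ wc Yc])
    have pc: "p \<in> carrier R" by (rule ideal.Icarr[OF Yi pq(2)])
    have "p \<in> L" using genideal_minimal[OF Li YL] pq(2) by blast
    then have "v \<ominus> p \<in> L" by (rule ideal_diff[OF Li v])
    moreover have "v \<ominus> p = q \<otimes> w" unfolding pq(3) using pq(1) pc wc by algebra
    ultimately have "q \<otimes> w \<in> L" by simp
    then have "q \<in> m" using unit_cancel_mem[OF Li pq(1) _ wc] w(2) by blast
    then show ?thesis using pq by blast
  qed
  have K: "ideal (Idl Y <+> ideal_power R m (Suc (Suc r))) R" (is "ideal ?K R")
    by (intro add_ideals Yi ideal_power_ideal is_ideal)
  \<comment> \<open>The part of \<open>I\<close> outside (Y) lies in m w, which has order two, so
    multiplying by m^r lands in m^(r+2). As I m^r = m^(r+1), Nakayama then puts m^(r+1) into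
    (Y).\<close>
  have "ideal_prod R I (ideal_power R m r) \<subseteq> ?K"
  proof (rule ideal_prod_subsetI[OF K])
    fix v z assume v: "v \<in> I" and z: "z \<in> ideal_power R m r"
    obtain p q where pq: "p \<in> Idl Y" "q \<in> m" "v = q \<otimes> w \<oplus> p" using Ldec[of v] v IL by blast
    have car: "p \<in> carrier R" "q \<in> carrier R" "z \<in> carrier R"
      using ideal.Icarr[OF Yi pq(1)] ideal.Icarr[OF is_ideal pq(2)]
        ideal.Icarr[OF ideal_power_ideal[OF is_ideal] z] by auto
    have "w \<otimes> z \<in> ideal_power R m (Suc r)"
      using ideal_power_mult_mem[OF is_ideal _ z, of w "Suc 0"] wm
      unfolding ideal_power_1[OF is_ideal] by simp
    then have "q \<otimes> (w \<otimes> z) \<in> ideal_power R m (Suc (Suc r))"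
      using ideal_power_mult_mem[OF is_ideal, of q "Suc 0" "w \<otimes> z" "Suc r"] pq(2)
      unfolding ideal_power_1[OF is_ideal] by simp
    moreover have "p \<otimes> z \<in> Idl Y" using pq(1) car(3) by (rule ideal.I_r_closed[OF Yi])
    ultimately have "p \<otimes> z \<oplus> q \<otimes> (w \<otimes> z) \<in> ?K" by (intro set_add_memI)
    moreover have "p \<otimes> z \<oplus> q \<otimes> (w \<otimes> z) = v \<otimes> z" unfolding pq(3) using car wc by algebra
    ultimately show "v \<otimes> z \<in> ?K" by simp
  qed
  then have "ideal_power R m (Suc r) \<subseteq> Idl Y"
    unfolding r by (rule nakayama_power[OF Yi])
  moreover have "finite Y" using S(2) by (simp add: Y_def)
  ultimately show False using few_elements_not_primary cardY Ym by blast
qed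

end


section \<open>Powers of the maximal ideal are full\<close>

lemma (in cring) elem_colon_ideal:
  assumes "ideal A R" "x \<in> carrier R"
  shows "elem_colon R A x = {r \<in> carrier R. r \<otimes> x \<in> A}"
proof -
  have "r \<otimes> (s \<otimes> x) \<in> A" if "r \<in> carrier R" "s \<in> carrier R" "r \<otimes> x \<in> A" for r s
    using ideal.I_l_closed[OF assms(1) that(3,2)] that assms(2) by (simp add: m_lcomm)
  then show ?thesis
    using cgenideal_self[OF assms(2)] by (auto simp: ideal_colon_def cgenideal_def)
qed

text \<open>A squeeze: m^n \<subseteq> m^(n+1) : m \<subseteq> m^(n+1) : x = m^n. Fullness of
  m^(n+1) uses this for n; the other two notions multiply by \<open>m\<close> once more and use it
  for n+1.\<close>

lemma (in regular_local_ring) powers_full: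
  assumes inf: "infinite (carrier (R Quot m))" and depth: "depth R m > 0"
  shows "m_full R m (ideal_power R m (Suc n))" "full R m (ideal_power R m (Suc n))"
    "weakly_m_full R m (ideal_power R m (Suc n))"
proof -
  \<comment> \<open>Positive depth excludes fields: if m = 0, the non-zero-divisor in
    \<open>m\<close> would be zero.\<close>
  have "emb_dim > 0"
  proof (rule ccontr)
    assume "\<not> emb_dim > 0"
    then have m0: "m = {\<zero>}" using minimal_generators genideal_empty by (metis card_0_eq gr0I)
    obtain x where x: "x \<in> m" "\<And>r. r \<in> carrier R \<Longrightarrow> r \<otimes> x = \<zero> \<Longrightarrow> r = \<zero>"
      using depth depth_pos_iff by blast
    have "x = \<zero>" using x(1) m0 by (metis singletonD)
    then have "\<one> = \<zero>" using x(2)[of \<one>] by simp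
    then show False using prime_one_compl[OF m_prime] ideal_zero[OF is_ideal] by simp
  qed
  then obtain x where x: "x \<in> m" "x \<notin> ideal_power R m (Suc (Suc 0))"
    "\<And>n r. r \<in> carrier R \<Longrightarrow> r \<otimes> x \<in> ideal_power R m (Suc n) \<Longrightarrow> r \<in> ideal_power R m n"
    using exists_superficial[OF inf] by blast
  have xc: "x \<in> carrier R" by (rule ideal.Icarr[OF is_ideal x(1)])
  have x2: "x \<in> m - ideal_power R m 2" using x(1,2) by (simp add: numeral_2_eq_2)
  note pow = ideal_power_ideal[OF is_ideal]
  have mem: "r \<otimes> b \<in> ideal_power R m (Suc n)" if "r \<in> ideal_power R m n" "b \<in> m" for r b n
    unfolding ideal_power_0_Suc using that by (rule ideal_prod.prod)
  have el: "elem_colon R (ideal_power R m (Suc n)) x = ideal_power R m n" for n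
    unfolding elem_colon_ideal[OF pow xc] using x(3) mem[OF _ x(1)] ideal.Icarr[OF pow] by blast
  have col: "ideal_colon R (ideal_power R m (Suc n)) m = ideal_power R m n" for n
    unfolding ideal_colon_def using x(1,3) mem ideal.Icarr[OF pow] by blast
  show "m_full R m (ideal_power R m (Suc n))"
    unfolding m_full_def using x2 el[of "Suc n"] unfolding ideal_power_0_Suc(2) by blast
  show "full R m (ideal_power R m (Suc n))"
    unfolding full_def using x2 el col by blast
  show "weakly_m_full R m (ideal_power R m (Suc n))"
    unfolding weakly_m_full_def using col[of "Suc n"] unfolding ideal_power_0_Suc(2) .
qed

theorem corollary3p11:
  fixes R :: "('a, 'b) ring_scheme" and m :: "'a set"
  assumes "regular_local_ring R m"
    and "infinite (carrier (R Quot m))"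
    and "depth R m > 0"
  shows "(\<forall>I. reduction R m I \<longrightarrow> n1 R m I = 0 \<and> n2 R m I = 0 \<and> n3 R m I = 0)
    \<and> n1 R m m = 0 \<and> n2 R m m = 0 \<and> n3 R m m = 0"
proof -
  interpret regular_local_ring R m by fact
  \<comment> \<open>The products in the definitions for I = m are thus exactly the positive powers,
    so t = 0 already qualifies.\<close>
  have "ideal_prod R m (ideal_power R m n) = ideal_power R m (Suc n)" for n
    unfolding ideal_power_0_Suc by (rule ideal_prod_commute[OF is_ideal ideal_power_ideal[OF is_ideal]])
  then have "n1 R m m = 0 \<and> n2 R m m = 0 \<and> n3 R m m = 0"
    unfolding n1_def n2_def n3_def using powers_full[OF assms(2,3)] by (simp add: Least_eq_0)
  then show ?thesis using reduction_eq by auto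
qed

end
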